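(* Let $0\leq q < t$ be integers, and let $F$ be a forest with at most $t$ edges, consisting of $s$ rooted trees $T_1, \ldots, T_s$, such that for each $i\in[s]$ we have $1\leq e(T_i) < \frac{t-q}{3}$. Let $r_1,\ldots,r_s$ be the roots of the corresponding trees. Consider a partially colored complete graph $B$ with $V(B) = U\cup V$ (disjoint union), $|U|=s$, $|V|=t$, such that $B$ contains a collection of $s$ vertex-disjoint blue stars with centers $u_1, \ldots, u_s\in U$ and with total number of edges equal to $q\leq t$, while all other edges of $B[U,V]$ and all edges of $B[V]$ are free. Then, playing the Waiter-Client game on $B$, Waiter can force a red copy $\bar F$ of $F$ within at most $e(F)+1$ rounds in such a way that: (a) every root $r_i$ is mapped to $u_i$; (b) every colored edge of $B$ intersects $V(\bar F)$; (c) no edges connecting two vertices of $U$ are offered by Waiter; (d) every vertex not in $V(\bar F)$ is incident with at most one colored edge of $B$, and the other endpoint of such an edge is not a leaf of $\bar F$.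
   Context: Waiter-Client game on a board $B$ (a complete graph, possibly with some edges already colored): in each round Waiter offers Client two free (uncolored) edges of $B$; Client colors one of them red and the other becomes blue. Waiter "forces a red copy of $F$ within $N$ rounds" if she has a strategy guaranteeing that after at most $N$ rounds the red graph contains a copy of $F$ (given by an embedding of $F$ into the red graph). A rooted tree is a tree with one designated vertex called its root. A leaf of a rooted forest is a vertex of degree 1 which is not a root; leaves of the copy $\bar F$ are the images of leaves of $F$. $e(\cdot)$ denotes the number of edges, $[s]=\{1,\dots,s\}$, and $B[U,V]$, $B[V]$ denote the bipartite subgraph between $U$ and $V$ and the induced subgraph on $V$. *)

theory Defs
  imports Complex_Main
begin

definition board_edges :: "'b set \<Rightarrow> 'b set set" where
  "board_edges W = {e. e \<subseteq> W \<and> card e = 2}"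

definition is_graph :: "'a set \<Rightarrow> 'a set set \<Rightarrow> bool" where
  "is_graph V E \<longleftrightarrow> finite V \<and> (\<forall>e\<in>E. e \<subseteq> V \<and> card e = 2)"

definition graph_connected :: "'a set \<Rightarrow> 'a set set \<Rightarrow> bool" where
  "graph_connected V E \<longleftrightarrow> (\<forall>x\<in>V. \<forall>y\<in>V. (\<lambda>a b. {a, b} \<in> E)\<^sup>*\<^sup>* x y)"

definition graph_acyclic :: "'a set \<Rightarrow> 'a set set \<Rightarrow> bool" where
  "graph_acyclic V E \<longleftrightarrow>
     \<not> (\<exists>cs. length cs \<ge> 3 \<and> distinct cs \<and> set cs \<subseteq> V
            \<and> (\<forall>i. Suc i < length cs \<longrightarrow> {cs ! i, cs ! Suc i} \<in> E)
            \<and> {last cs, hd cs} \<in> E)"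

definition is_tree :: "'a set \<Rightarrow> 'a set set \<Rightarrow> bool" where
  "is_tree V E \<longleftrightarrow> is_graph V E \<and> V \<noteq> {} \<and> graph_connected V E \<and> graph_acyclic V E"

text \<open>State: sets of red and blue edges of the complete board on vertex set W.
  waiter_wins Goal Ok W n R Bl: Waiter can guarantee that within at most n further
  rounds the state satisfies Goal, where in each round she offers two distinct free
  edges e1, e2 (both satisfying Ok), and Client colours one red, the other blue.\<close>

primrec waiter_wins ::
  "('b set set \<Rightarrow> 'b set set \<Rightarrow> bool) \<Rightarrow> ('b set \<Rightarrow> bool) \<Rightarrow> 'b set \<Rightarrow> nat
     \<Rightarrow> 'b set set \<Rightarrow> 'b set set \<Rightarrow> bool" where
  "waiter_wins Goal Ok W 0 R Bl = Goal R Bl"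
| "waiter_wins Goal Ok W (Suc n) R Bl =
     (Goal R Bl \<or>
      (\<exists>e1 e2. e1 \<noteq> e2 \<and> e1 \<in> board_edges W - (R \<union> Bl) \<and> e2 \<in> board_edges W - (R \<union> Bl)
         \<and> Ok e1 \<and> Ok e2
         \<and> waiter_wins Goal Ok W n (insert e1 R) (insert e2 Bl)
         \<and> waiter_wins Goal Ok W n (insert e2 R) (insert e1 Bl)))"

end

theory Submission
  imports Defs
begin

text \<open>
  Embed the forest from the roots downwards. In a \<^emph>\<open>pair move\<close> Waiter offers one pool vertex \<open>v\<close> to two
  embedded vertices that still need children, so \<open>v\<close> is embedded whatever Client does. In a
  \<^emph>\<open>sure move\<close> she offers two pool vertices to the same embedded vertex; the rejected one becomes
  \<^emph>\<open>dirty\<close>, i.e. it has a blue edge. Let \<open>M\<close> be the largest number of edges still missing below an embedded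
  vertex. Dirty pool vertices are used up by pair moves avoiding their blue neighbour, or discarded if
  at most one other embedded vertex needs children (then the pool is larger than necessary). With a clean
  pool, pair moves on trees of size \<open>M\<close>, followed by a sure move once a single such tree is left,
  lower \<open>M\<close>. The hypothesis \<open>3 e(T\<^sub>i) < t - q\<close> is just enough to keep this going until \<open>M = 1\<close>.
  If the pool then has no spare vertex, at least four leaves are missing. Waiter attaches two
  of them, \<open>l\<^sub>0\<close> and \<open>l\<^sub>1\<close>, by sure moves and all but the last by pair moves, keeping one pool vertex \<open>p\<close>
  untouched. If \<open>x\<close> is the vertex that needs the last leaf, she offers \<open>p\<close> to the parents of \<open>l\<^sub>0\<close> and
  \<open>l\<^sub>1\<close>, and then offers \<open>x\<close> the edges to \<open>p\<close> and to the \<open>l\<^sub>j\<close> that \<open>p\<close> can replace: one wasted round.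
\<close>

section \<open>Parent functions of rooted trees\<close>

text \<open>Loop erasure: when a step returns to a vertex already on the path, the path is cut
  there. Keeping the path inside \<open>S\<close> fits \<open>graph_acyclic\<close>, which only
  speaks of cycles in \<open>V\<close>.\<close>

lemma rtranclp_imp_distinct_path:
  assumes "r\<^sup>*\<^sup>* a b" "a \<in> S" "\<And>x y. r x y \<Longrightarrow> y \<in> S"
  shows "\<exists>cs. cs \<noteq> [] \<and> hd cs = a \<and> last cs = b \<and> distinct cs \<and> set cs \<subseteq> S \<and> successively r cs"
  using assms(1)
proof (induction rule: rtranclp_induct)
  case base
  show ?case by (rule exI[of _ "[a]"]) (use assms(2) in auto)
next
  case (step y z)
  then obtain cs where cs: "cs \<noteq> []" "hd cs = a" "last cs = y" "distinct cs" "set cs \<subseteq> S"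
    "successively r cs" by blast
  show ?case
  proof (cases "z \<in> set cs")
    case True
    then obtain xs ys where "cs = xs @ z # ys" by (meson split_list)
    moreover from this have "successively r (xs @ [z])"
      using cs(6) by (auto simp: successively_append_iff)
    ultimately show ?thesis
      using cs by (intro exI[of _ "xs @ [z]"]) (cases xs; auto)
  next
    case False
    then show ?thesis
      using cs step.hyps assms(3)
      by (intro exI[of _ "cs @ [z]"]) (auto simp: successively_append_iff)
  qed
qed

text \<open>Breadth-first search: \<open>dep\<close> is the distance from \<open>r\<close>, and
  \<open>par y\<close> is a neighbour closer to \<open>r\<close>. The parent edges already join
  every vertex to \<open>r\<close>, so any further edge would close a cycle.\<close>

lemma tree_parent_function:
  assumes tree: "is_tree V E" and r: "r \<in> V"
  shows "\<exists>par dep. (\<forall>y\<in>V - {r}. par y \<in> V \<and> dep (par y) < (dep y :: nat))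
    \<and> E = (\<lambda>y. {y, par y}) ` (V - {r})"
proof -
  have edge: "e \<subseteq> V \<and> card e = 2" if "e \<in> E" for e
    using tree that by (auto simp: is_tree_def is_graph_def)
  define adj where "adj a b \<longleftrightarrow> {a, b} \<in> E" for a b
  have adjV: "x \<in> V \<and> y \<in> V" if "adj x y" for x y
    using edge that by (auto simp: adj_def)
  have conn: "adj\<^sup>*\<^sup>* x y" if "x \<in> V" "y \<in> V" for x y
    using tree that by (auto simp: is_tree_def graph_connected_def adj_def[abs_def])
  define dist where "dist y = (LEAST n. (adj ^^ n) r y)" for y
  have reach: "(adj ^^ dist y) r y" if "y \<in> V" for y
    unfolding dist_def using conn[OF r that] by (meson LeastI rtranclp_imp_relpowp)
  have "\<exists>z. adj z y \<and> dist z < dist y" if y: "y \<in> V - {r}" for y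
  proof -
    obtain k where k: "dist y = Suc k"
      using reach[of y] y by (cases "dist y") auto
    obtain z where z: "(adj ^^ k) r z" "adj z y"
      using reach[of y] y unfolding k by auto
    have "dist z \<le> k"
      unfolding dist_def using z(1) by (rule Least_le)
    with z k show ?thesis by auto
  qed
  then obtain par where par: "\<And>y. y \<in> V - {r} \<Longrightarrow> adj (par y) y \<and> dist (par y) < dist y"
    by metis
  define E' where "E' = (\<lambda>y. {y, par y}) ` (V - {r})"
  define adj' where "adj' a b \<longleftrightarrow> {a, b} \<in> E'" for a b
  have sub: "E' \<subseteq> E"
    using par by (auto simp: E'_def adj_def insert_commute)
  have sym: "adj'\<^sup>*\<^sup>* b a" if "adj'\<^sup>*\<^sup>* a b" for a b
  proof -
    have "symp adj'" by (auto simp: symp_def adj'_def insert_commute)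
    then show ?thesis using that by (meson symp_rtranclp sympD)
  qed
  have toroot: "adj'\<^sup>*\<^sup>* y r" if "y \<in> V" for y
    using that
  proof (induction "dist y" arbitrary: y rule: less_induct)
    case less
    show ?case
    proof (cases "y = r")
      case False
      then have y: "y \<in> V - {r}" using less by auto
      have "adj' y (par y)" using y by (auto simp: adj'_def E'_def)
      moreover have "adj'\<^sup>*\<^sup>* (par y) r"
        using less(1)[of "par y"] par[OF y] adjV by auto
      ultimately show ?thesis by (rule converse_rtranclp_into_rtranclp)
    qed auto
  qed
  \<comment> \<open>The cycle is a simple path of parent edges from \<open>a\<close> to
    \<open>b\<close>, closed by \<open>{a, b}\<close>. A path with one vertex would mean
    \<open>a = b\<close>; with two, \<open>{a, b}\<close> itself would be a parent edge.\<close>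
  have "E \<subseteq> E'"
  proof
    fix e assume e: "e \<in> E"
    then obtain a b where ab: "e = {a, b}" "a \<noteq> b"
      using edge by (meson card_2_iff)
    have abV: "a \<in> V" "b \<in> V" using edge[OF e] ab by auto
    show "e \<in> E'"
    proof (rule ccontr)
      assume n: "e \<notin> E'"
      have "adj'\<^sup>*\<^sup>* a b"
        using toroot[OF abV(1)] sym[OF toroot[OF abV(2)]] by (rule rtranclp_trans)
      moreover have "y \<in> V" if "adj' x y" for x y
        using that adjV sub by (auto simp: adj'_def adj_def)
      ultimately obtain cs where cs: "cs \<noteq> []" "hd cs = a" "last cs = b" "distinct cs"
        "set cs \<subseteq> V" "successively adj' cs"
        using rtranclp_imp_distinct_path[of adj' a b V] abV by blast
      have "length cs \<ge> 3"
      proof (rule ccontr)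
        assume "\<not> ?thesis"
        moreover have "length cs \<noteq> 0" using cs(1) by simp
        ultimately have "length cs = 1 \<or> length cs = 2" by linarith
        then show False
          using cs ab n by (auto simp: length_Suc_conv numeral_2_eq_2 adj'_def)
      qed
      moreover have "\<forall>i. Suc i < length cs \<longrightarrow> {cs ! i, cs ! Suc i} \<in> E"
        using cs(6) sub by (auto simp: successively_conv_nth adj'_def)
      moreover have "{last cs, hd cs} \<in> E"
        using e ab cs by (simp add: insert_commute)
      ultimately have "\<not> graph_acyclic V E"
        using cs unfolding graph_acyclic_def by blast
      then show False using tree by (simp add: is_tree_def)
    qed
  qed
  then have "E = E'" using sub by auto
  moreover have "\<forall>y\<in>V - {r}. par y \<in> V \<and> dist (par y) < dist y"
    using par adjV by blast
  ultimately show ?thesis unfolding E'_def by blast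
qed

text \<open>Two different vertices with the same parent edge would be each other's parents, and the
  depth would drop both ways.\<close>

lemma inj_on_parent_edge:
  assumes "\<And>y. y \<in> Y \<Longrightarrow> dep (par y) < (dep y :: nat)"
  shows "inj_on (\<lambda>y. {y, par y}) Y"
proof (rule inj_onI)
  fix y z assume "y \<in> Y" "z \<in> Y" "{y, par y} = {z, par z}"
  then show "y = z" using assms[of y] assms[of z] by (auto simp: doubleton_eq_iff)
qed

section \<open>Residual trees of a partially embedded forest\<close>

locale rooted_forest =
  fixes VF Rt :: "'a set" and par :: "'a \<Rightarrow> 'a" and dep :: "'a \<Rightarrow> nat"
  assumes finite_VF: "finite VF" and Rt_VF: "Rt \<subseteq> VF"
    and par_VF: "y \<in> VF - Rt \<Longrightarrow> par y \<in> VF"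
    and dep_par: "y \<in> VF - Rt \<Longrightarrow> dep (par y) < dep y"
begin

definition parent_closed :: "'a set \<Rightarrow> bool" where
  "parent_closed A \<longleftrightarrow> Rt \<subseteq> A \<and> A \<subseteq> VF \<and> (\<forall>y\<in>A - Rt. par y \<in> A)"

text \<open>The closest ancestor of \<open>y\<close> in \<open>A\<close>, where \<open>y\<close>
  counts as its own ancestor.\<close>

definition nearest :: "'a set \<Rightarrow> 'a \<Rightarrow> 'a" where
  "nearest A y = (par ^^ (LEAST n. (par ^^ n) y \<in> A)) y"

text \<open>The number of edges still to be built below \<open>x\<close>: each missing vertex stands
  for its parent edge.\<close>

definition residual :: "'a set \<Rightarrow> 'a \<Rightarrow> nat" where
  "residual A x = card {y \<in> VF - A. nearest A y = x}"

text \<open>Roots are included because a root never counts as a leaf in condition (d).\<close>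

definition nonleaf :: "'a \<Rightarrow> bool" where
  "nonleaf x \<longleftrightarrow> x \<in> Rt \<or> (\<exists>y\<in>VF - Rt. par y = x)"

lemma forest_induct [consumes 1, case_names step]:
  assumes "y \<in> VF" and "\<And>y. y \<in> VF \<Longrightarrow> (y \<notin> Rt \<Longrightarrow> Q (par y)) \<Longrightarrow> Q y"
  shows "Q y"
  using assms(1)
proof (induction "dep y" arbitrary: y rule: less_induct)
  case less
  then show ?case using assms(2) dep_par par_VF by blast
qed

lemma nearest_in: "y \<in> A \<Longrightarrow> nearest A y = y"
proof -
  assume "y \<in> A"
  then have "(LEAST n. (par ^^ n) y \<in> A) = 0" by (intro Least_eq_0) simp
  then show ?thesis by (simp add: nearest_def)
qed

text \<open>The search for an ancestor of a missing vertex may start one step higher.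
  \<open>Least_Suc\<close> asks for some ancestor in \<open>A\<close>; climbing reaches a root, and
  the roots lie in \<open>A\<close>.\<close>

lemma nearest_step:
  assumes "parent_closed A" "y \<in> VF - A"
  shows "nearest A y = nearest A (par y)"
proof -
  have "y \<in> VF" using assms by simp
  then have "\<exists>n. (par ^^ n) y \<in> A"
  proof (induction rule: forest_induct)
    case (step y)
    show ?case
    proof (cases "y \<in> Rt")
      case True
      then show ?thesis using assms(1) by (intro exI[of _ 0]) (auto simp: parent_closed_def)
    next
      case False
      then obtain n where "(par ^^ n) (par y) \<in> A" using step by blast
      then show ?thesis
        by (intro exI[of _ "Suc n"]) (simp add: funpow_Suc_right del: funpow.simps)
    qed
  qed
  then obtain n where n: "(par ^^ n) y \<in> A" ..
  have "(LEAST n. (par ^^ n) y \<in> A) = Suc (LEAST n. (par ^^ Suc n) y \<in> A)"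
    by (rule Least_Suc[where P = "\<lambda>n. (par ^^ n) y \<in> A", OF n]) (use assms in simp)
  then show ?thesis
    unfolding nearest_def by (simp only: funpow_Suc_right o_apply)
qed

lemma closed_Rt: "parent_closed A \<Longrightarrow> y \<in> VF - A \<Longrightarrow> y \<in> VF - Rt"
  by (auto simp: parent_closed_def)

lemma closed_subset: "parent_closed A \<Longrightarrow> A \<subseteq> VF"
  by (auto simp: parent_closed_def)

lemma closed_finite: "parent_closed A \<Longrightarrow> finite A"
  using finite_VF finite_subset closed_subset by blast

lemma closed_insert: "parent_closed A \<Longrightarrow> c \<in> VF - A \<Longrightarrow> par c \<in> A \<Longrightarrow> parent_closed (insert c A)"
  by (auto simp: parent_closed_def)

lemma nearest_mem:
  assumes "parent_closed A" "y \<in> VF"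
  shows "nearest A y \<in> A"
  using assms(2)
proof (induction rule: forest_induct)
  case (step y)
  then show ?case
    by (cases "y \<in> A") (use assms(1) closed_Rt nearest_in nearest_step in auto)
qed

text \<open>\<open>nearest A\<close> sorts the missing vertices into classes, one for each embedded
  vertex.\<close>

lemma sum_residual:
  assumes "parent_closed A"
  shows "(\<Sum>x\<in>A. residual A x) = card (VF - A)"
proof -
  have "(\<Sum>x\<in>A. \<Sum>y\<in>{y \<in> VF - A. nearest A y = x}. 1::nat) = (\<Sum>y\<in>VF - A. 1)"
    by (rule sum.group) (use finite_VF closed_finite[OF assms] nearest_mem[OF assms] in auto)
  then show ?thesis by (simp add: residual_def)
qed

text \<open>Only descendants of \<open>c\<close> can change their nearest embedded ancestor. Going
  down the tree, \<open>y\<close> inherits the alternative from \<open>par y\<close> unless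
  \<open>par y\<close> is itself embedded.\<close>

lemma nearest_insert:
  assumes A: "parent_closed A" and c: "c \<in> VF - A" "par c \<in> A" and y: "y \<in> VF"
  shows "y \<notin> insert c A \<Longrightarrow>
    nearest (insert c A) y = nearest A y \<or> nearest (insert c A) y = c \<and> nearest A y = par c"
  using y
proof (induction rule: forest_induct)
  case (step y)
  have A': "parent_closed (insert c A)" by (rule closed_insert[OF A c])
  have yR: "y \<notin> Rt" using step A by (auto simp: parent_closed_def)
  have 1: "nearest (insert c A) y = nearest (insert c A) (par y)"
    using nearest_step[OF A'] step by auto
  have 2: "nearest A y = nearest A (par y)"
    using nearest_step[OF A] step by auto
  show ?case
  proof (cases "par y \<in> insert c A")
    case True
    then show ?thesis
      using 1 2 nearest_in nearest_step[OF A c(1)] c by auto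
  next
    case False
    then show ?thesis using 1 2 step yR by auto
  qed
qed

text \<open>Embedding \<open>c\<close> takes it out of the residual tree at \<open>par c\<close> and
  divides the rest of that tree between \<open>par c\<close> and \<open>c\<close>. The
  \<open>Suc\<close> makes both parts strictly smaller than the old tree.\<close>

lemma residual_insert:
  assumes A: "parent_closed A" and c: "c \<in> VF - A" "par c \<in> A"
  shows "residual A (par c) = Suc (residual (insert c A) (par c) + residual (insert c A) c)"
    and "z \<in> A \<Longrightarrow> z \<noteq> par c \<Longrightarrow> residual (insert c A) z = residual A z"
proof -
  have near_c: "nearest A c = par c"
    using nearest_step[OF A c(1)] nearest_in c by auto
  have neq: "nearest A y \<noteq> c" if "y \<in> VF" for y
    using nearest_mem[OF A that] c by auto
  have neq': "par c \<noteq> c" using c by auto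
  let ?S = "\<lambda>B x. {y \<in> VF - B. nearest B y = x}"
  note ins = nearest_insert[OF A c]
  have "?S A (par c) = insert c (?S (insert c A) (par c) \<union> ?S (insert c A) c)"
    using near_c c neq neq' ins by (auto; metis)
  moreover have "card (insert c (?S (insert c A) (par c) \<union> ?S (insert c A) c))
      = Suc (card (?S (insert c A) (par c)) + card (?S (insert c A) c))"
    using finite_VF neq' by (subst card_insert_disjoint) (auto intro!: card_Un_disjoint)
  ultimately show "residual A (par c) = Suc (residual (insert c A) (par c) + residual (insert c A) c)"
    by (simp add: residual_def)
  show "residual (insert c A) z = residual A z" if "z \<in> A" "z \<noteq> par c"
  proof -
    have "?S (insert c A) z = ?S A z"
      using near_c c that ins by (auto; metis)
    then show ?thesis by (simp add: residual_def)
  qed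
qed

text \<open>Climbing from a missing vertex counted at \<open>x\<close>, the last vertex before
  entering \<open>A\<close> is a child of \<open>x\<close>.\<close>

lemma residual_pos_child:
  assumes A: "parent_closed A" and "residual A x > 0"
  shows "\<exists>c\<in>VF - A. par c = x"
proof -
  obtain y where y: "y \<in> VF - A" "nearest A y = x"
    using assms(2) by (auto simp: residual_def card_gt_0_iff)
  have "y \<in> VF" using y by simp
  then show ?thesis using y
  proof (induction rule: forest_induct)
    case (step y)
    have "nearest A (par y) = x" using step nearest_step[OF A] by auto
    then show ?case
      using step closed_Rt[OF A] nearest_in par_VF by (cases "par y \<in> A") auto
  qed
qed

text \<open>Two missing vertices with the same nearest embedded ancestor must coincide. Hence no
  missing vertex has a missing parent, and no two share one: the missing vertices are leaves with
  distinct embedded parents, which is where the endgame starts.\<close>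

lemma residual_le_one:
  assumes A: "parent_closed A" and le: "\<And>x. x \<in> A \<Longrightarrow> residual A x \<le> 1"
  shows "c \<in> VF - A \<Longrightarrow> par c \<in> A" and "inj_on par (VF - A)"
proof -
  have uniq: "y = z" if "y \<in> VF - A" "z \<in> VF - A" "nearest A y = nearest A z" for y z
  proof -
    have "nearest A y \<in> A" using nearest_mem[OF A] that by simp
    then have "card {z \<in> VF - A. nearest A z = nearest A y} \<le> 1"
      using le unfolding residual_def by blast
    then show ?thesis
      using that finite_VF by (auto simp: card_le_Suc0_iff_eq)
  qed
  show 1: "par c \<in> A" if c: "c \<in> VF - A" for c
  proof (rule ccontr)
    assume "par c \<notin> A"
    then have "par c \<in> VF - A" using par_VF closed_Rt[OF A c] by auto
    then have "par c = c" using uniq[of "par c" c] nearest_step[OF A c] c by auto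
    then show False using dep_par[OF closed_Rt[OF A c]] by auto
  qed
  show "inj_on par (VF - A)"
    by (rule inj_onI) (use uniq nearest_step[OF A] in metis)
qed

end

section \<open>The game\<close>

lemma waiter_wins_goal: "Goal R B \<Longrightarrow> waiter_wins Goal Ok W n R B"
  by (cases n) auto

text \<open>That all coloured edges lie on the board is carried through the game, because reading
  (b) and (d) off the final position uses that edges are nonempty and finite in number.\<close>

lemma waiter_wins_mono:
  assumes "\<And>R B. Goal R B \<Longrightarrow> R \<union> B \<subseteq> board_edges W \<Longrightarrow> Goal' R B"
  shows "waiter_wins Goal Ok W n R B \<Longrightarrow> R \<union> B \<subseteq> board_edges W \<Longrightarrow> waiter_wins Goal' Ok W n R B"
proof (induction n arbitrary: R B)
  case 0
  then show ?case using assms by simp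
next
  case (Suc n)
  show ?case
  proof (cases "Goal R B")
    case True
    then show ?thesis using assms Suc.prems(2) by simp
  next
    case False
    then obtain e1 e2 where e: "e1 \<noteq> e2" "e1 \<in> board_edges W - (R \<union> B)"
      "e2 \<in> board_edges W - (R \<union> B)" "Ok e1" "Ok e2"
      "waiter_wins Goal Ok W n (insert e1 R) (insert e2 B)"
      "waiter_wins Goal Ok W n (insert e2 R) (insert e1 B)"
      using Suc.prems(1) unfolding waiter_wins.simps by metis
    then have "insert e1 R \<union> insert e2 B \<subseteq> board_edges W" "insert e2 R \<union> insert e1 B \<subseteq> board_edges W"
      using Suc.prems(2) by auto
    then have "waiter_wins Goal' Ok W n (insert e1 R) (insert e2 B)"
      "waiter_wins Goal' Ok W n (insert e2 R) (insert e1 B)"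
      using Suc.IH e by blast+
    then show ?thesis unfolding waiter_wins.simps using e by metis
  qed
qed

declare waiter_wins.simps(2) [simp del]

locale forest_board = rooted_forest VF Rt par dep
  for VF Rt :: "'a set" and par :: "'a \<Rightarrow> 'a" and dep :: "'a \<Rightarrow> nat" +
  fixes U V :: "'b set" and pos :: "'a \<Rightarrow> 'b"
  assumes finite_V: "finite V" and disjoint_UV: "U \<inter> V = {}"
begin

text \<open>\<open>A\<close> is the embedded part of the forest and \<open>P\<close> the pool of vertices still to be used.
  A vertex outside both has been discarded, so it must already satisfy condition (d).\<close>

definition placed :: "'a set \<Rightarrow> ('a \<Rightarrow> 'b) \<Rightarrow> 'b set \<Rightarrow> 'b set set \<Rightarrow> 'b set set \<Rightarrow> bool" where
  "placed A \<phi> P R B \<longleftrightarrow> parent_closed A \<and> inj_on \<phi> A \<and> \<phi> ` A \<subseteq> U \<union> V \<and> P \<subseteq> V \<and> \<phi> ` A \<inter> P = {}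
    \<and> (\<forall>x\<in>Rt. \<phi> x = pos x) \<and> (\<forall>y\<in>A - Rt. {\<phi> y, \<phi> (par y)} \<in> R)
    \<and> (\<forall>e\<in>R \<union> B. e \<subseteq> \<phi> ` A \<union> P
          \<or> (\<exists>w x. e = {w, \<phi> x} \<and> w \<notin> \<phi> ` A \<union> P \<and> x \<in> A \<and> nonleaf x))
    \<and> (\<forall>w. w \<notin> \<phi> ` A \<union> P \<longrightarrow> (\<forall>e\<in>R \<union> B. \<forall>e'\<in>R \<union> B. w \<in> e \<longrightarrow> w \<in> e' \<longrightarrow> e = e'))"

text \<open>\<open>D\<close> contains all dirty pool vertices. A pool vertex has at most one
  coloured edge, leading to the image of a non-leaf, so it may be discarded at any time without
  violating (d).\<close>

definition tidy :: "'a set \<Rightarrow> ('a \<Rightarrow> 'b) \<Rightarrow> 'b set \<Rightarrow> 'b set \<Rightarrow> 'b set set \<Rightarrow> 'b set set \<Rightarrow> bool" where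
  "tidy A \<phi> P D R B \<longleftrightarrow> D \<subseteq> P
    \<and> (\<forall>p\<in>P. \<forall>e\<in>R \<union> B. p \<in> e \<longrightarrow> p \<in> D \<and> (\<exists>x\<in>A. nonleaf x \<and> e = {p, \<phi> x}))
    \<and> (\<forall>p\<in>P. \<forall>e\<in>R \<union> B. \<forall>e'\<in>R \<union> B. p \<in> e \<longrightarrow> p \<in> e' \<longrightarrow> e = e')"

text \<open>With an empty pool every vertex off the image counts as discarded, so the goal yields
  (d), and (b) for nonempty edges.\<close>

abbreviation wins :: "nat \<Rightarrow> 'b set set \<Rightarrow> 'b set set \<Rightarrow> bool" where
  "wins \<equiv> waiter_wins (\<lambda>R B. \<exists>\<phi>. placed VF \<phi> {} R B) (\<lambda>e. \<not> e \<subseteq> U) (U \<union> V)"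

section \<open>Access rules for the two invariants\<close>

lemma placedI:
  assumes "parent_closed A" "inj_on \<phi> A" "\<phi> ` A \<subseteq> U \<union> V" "P \<subseteq> V" "\<phi> ` A \<inter> P = {}"
    and "\<And>x. x \<in> Rt \<Longrightarrow> \<phi> x = pos x" and "\<And>y. y \<in> A - Rt \<Longrightarrow> {\<phi> y, \<phi> (par y)} \<in> R"
    and "\<And>e. e \<in> R \<union> B \<Longrightarrow> e \<subseteq> \<phi> ` A \<union> P
          \<or> (\<exists>w x. e = {w, \<phi> x} \<and> w \<notin> \<phi> ` A \<union> P \<and> x \<in> A \<and> nonleaf x)"
    and "\<And>w e e'. w \<notin> \<phi> ` A \<union> P \<Longrightarrow> e \<in> R \<union> B \<Longrightarrow> e' \<in> R \<union> B \<Longrightarrow> w \<in> e \<Longrightarrow> w \<in> e' \<Longrightarrow> e = e'"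
  shows "placed A \<phi> P R B"
  unfolding placed_def
  by (intro conjI; (fact assms(1-5) | (intro ballI allI impI; rule assms(6-9); assumption)))

lemma placed_edge:
  assumes "placed A \<phi> P R B" "e \<in> R \<union> B"
  obtains "e \<subseteq> \<phi> ` A \<union> P" | w x where "e = {w, \<phi> x}" "w \<notin> \<phi> ` A \<union> P" "x \<in> A" "nonleaf x"
proof -
  have "e \<subseteq> \<phi> ` A \<union> P \<or> (\<exists>w x. e = {w, \<phi> x} \<and> w \<notin> \<phi> ` A \<union> P \<and> x \<in> A \<and> nonleaf x)"
    using assms by (simp add: placed_def)
  then show thesis using that by metis
qed

lemma placed_edge_unique:
  assumes "placed A \<phi> P R B"
    and "w \<notin> \<phi> ` A \<union> P" "e \<in> R \<union> B" "e' \<in> R \<union> B" "w \<in> e" "w \<in> e'"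
  shows "e = e'"
proof -
  have "\<forall>w. w \<notin> \<phi> ` A \<union> P \<longrightarrow> (\<forall>e\<in>R \<union> B. \<forall>e'\<in>R \<union> B. w \<in> e \<longrightarrow> w \<in> e' \<longrightarrow> e = e')"
    using assms(1) unfolding placed_def by (elim conjE)
  then show ?thesis using assms(2-) by metis
qed

lemma tidyI:
  assumes "D \<subseteq> P"
    and "\<And>p e. p \<in> P \<Longrightarrow> p \<in> e \<Longrightarrow> e \<in> R \<union> B \<Longrightarrow> p \<in> D"
    and "\<And>p e. p \<in> P \<Longrightarrow> p \<in> e \<Longrightarrow> e \<in> R \<union> B \<Longrightarrow> \<exists>x\<in>A. nonleaf x \<and> e = {p, \<phi> x}"
    and "\<And>p e e'. p \<in> P \<Longrightarrow> p \<in> e \<Longrightarrow> p \<in> e' \<Longrightarrow> e \<in> R \<union> B \<Longrightarrow> e' \<in> R \<union> B \<Longrightarrow> e = e'"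
  shows "tidy A \<phi> P D R B"
  unfolding tidy_def by (intro conjI ballI impI assms(1)) (rule assms(2-4); assumption)+

lemma tidy_edge:
  assumes "tidy A \<phi> P D R B" "p \<in> P" "p \<in> e" "e \<in> R \<union> B"
  shows "p \<in> D" "\<exists>x\<in>A. nonleaf x \<and> e = {p, \<phi> x}"
  using assms by (simp_all add: tidy_def)

lemma tidy_edge_unique:
  assumes "tidy A \<phi> P D R B" "p \<in> P" "p \<in> e" "p \<in> e'" "e \<in> R \<union> B" "e' \<in> R \<union> B"
  shows "e = e'"
proof -
  have "\<forall>p\<in>P. \<forall>e\<in>R \<union> B. \<forall>e'\<in>R \<union> B. p \<in> e \<longrightarrow> p \<in> e' \<longrightarrow> e = e'"
    using assms(1) unfolding tidy_def by (elim conjE)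
  then show ?thesis using assms(2-) by metis
qed

section \<open>Single moves and their effect on the invariants\<close>

lemma placed_finite:
  assumes "placed A \<phi> P R B"
  shows "finite A" "finite P" "parent_closed A"
  using assms closed_finite finite_subset[OF _ finite_V] by (simp_all add: placed_def)

text \<open>Asking for one end in \<open>V\<close> enforces (c). That end need not be in the pool:
  the last round of the endgame offers an edge to an embedded leaf.\<close>

lemma wins_offer:
  assumes pl: "placed A \<phi> P R B" and x: "x \<in> A" "y \<in> A" and v: "v \<in> V" "w \<in> V"
    and ne: "{\<phi> x, v} \<noteq> {\<phi> y, w}" "\<phi> x \<noteq> v" "\<phi> y \<noteq> w"
    and free: "{\<phi> x, v} \<notin> R \<union> B" "{\<phi> y, w} \<notin> R \<union> B"
    and "wins n (insert {\<phi> x, v} R) (insert {\<phi> y, w} B)"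
    and "wins n (insert {\<phi> y, w} R) (insert {\<phi> x, v} B)"
  shows "wins (Suc n) R B"
proof -
  have "\<phi> x \<in> U \<union> V" "\<phi> y \<in> U \<union> V"
    using pl x by (auto simp: placed_def)
  then have board: "{\<phi> x, v} \<in> board_edges (U \<union> V) - (R \<union> B)" "{\<phi> y, w} \<in> board_edges (U \<union> V) - (R \<union> B)"
    using v ne free by (auto simp: board_edges_def)
  have ok: "\<not> {\<phi> x, v} \<subseteq> U" "\<not> {\<phi> y, w} \<subseteq> U"
    using v disjoint_UV by auto
  show ?thesis
    unfolding waiter_wins.simps
    by (intro disjI2 exI[of _ "{\<phi> x, v}"] exI[of _ "{\<phi> y, w}"] conjI)
      (fact ne(1) board ok assms(11,12))+
qed

text \<open>Moving \<open>v\<close> from the pool to the image leaves their union unchanged, so the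
  conditions on discarded vertices persist. The blue edge \<open>f\<close> is left general to serve
  pair moves, sure moves and the final round.\<close>

lemma placed_extend:
  assumes pl: "placed A \<phi> P R B" and c: "c \<in> VF - A" "par c \<in> A" and v: "v \<in> P"
    and f: "f \<subseteq> \<phi> ` A \<union> P"
  shows "placed (insert c A) (\<phi>(c := v)) (P - {v}) (insert {\<phi> (par c), v} R) (insert f B)"
proof -
  have A: "parent_closed A" using pl by (simp add: placed_def)
  have cR: "c \<notin> Rt" using closed_Rt[OF A c(1)] by simp
  have same: "(\<phi>(c := v)) ` insert c A \<union> (P - {v}) = \<phi> ` A \<union> P"
    using c v by auto
  have eq: "(\<phi>(c := v)) x = \<phi> x" if "x \<in> A" for x using that c by auto
  have img: "(\<phi>(c := v)) ` insert c A = insert v (\<phi> ` A)" using c by auto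
  have red: "{(\<phi>(c := v)) y, (\<phi>(c := v)) (par y)} \<in> insert {\<phi> (par c), v} R"
    if "y \<in> insert c A - Rt" for y
  proof (cases "y = c")
    case True
    then show ?thesis using c by (auto simp: insert_commute)
  next
    case False
    then have "y \<in> A - Rt" "par y \<in> A" using that A by (auto simp: parent_closed_def)
    then show ?thesis using pl eq by (auto simp: placed_def)
  qed
  have inj: "inj_on (\<phi>(c := v)) (insert c A)"
    using pl c v by (auto simp: placed_def inj_on_def)
  let ?R = "insert {\<phi> (par c), v} R" and ?B = "insert f B"
  have new: "{\<phi> (par c), v} \<subseteq> \<phi> ` A \<union> P" using c v by auto
  show ?thesis
  proof (rule placedI, unfold same)
    show "parent_closed (insert c A)" by (rule closed_insert[OF A c])
    show "inj_on (\<phi>(c := v)) (insert c A)" by (rule inj)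
    show "(\<phi>(c := v)) ` insert c A \<subseteq> U \<union> V" "P - {v} \<subseteq> V"
      "(\<phi>(c := v)) ` insert c A \<inter> (P - {v}) = {}"
      using pl v unfolding img placed_def by auto
    show "(\<phi>(c := v)) x = pos x" if "x \<in> Rt" for x
      using pl that cR by (auto simp: placed_def)
    show "{(\<phi>(c := v)) y, (\<phi>(c := v)) (par y)} \<in> ?R" if "y \<in> insert c A - Rt" for y
      by (rule red[OF that])
    show "e \<subseteq> \<phi> ` A \<union> P
      \<or> (\<exists>w x. e = {w, (\<phi>(c := v)) x} \<and> w \<notin> \<phi> ` A \<union> P \<and> x \<in> insert c A \<and> nonleaf x)"
      if e: "e \<in> ?R \<union> ?B" for e
    proof (cases "e \<in> R \<union> B")
      case True
      show ?thesis
        using pl True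
      proof (cases rule: placed_edge)
        case (2 w x)
        then show ?thesis using eq[of x] by (metis insertCI)
      qed auto
    next
      case False
      then have "e = f \<or> e = {\<phi> (par c), v}" using e by auto
      then show ?thesis using f new by metis
    qed
    show "e = e'" if w: "w \<notin> \<phi> ` A \<union> P" and e: "e \<in> ?R \<union> ?B" "e' \<in> ?R \<union> ?B" "w \<in> e" "w \<in> e'"
      for w e e'
    proof -
      have "d \<in> R \<union> B" if "d \<in> ?R \<union> ?B" "w \<in> d" for d
        using that f new w by blast
      then show ?thesis using placed_edge_unique[OF pl w] e by metis
    qed
  qed
qed

text \<open>The pair move: both new edges meet the pool only in \<open>v\<close>, which leaves
  it.\<close>

lemma tidy_extend:
  assumes pl: "placed A \<phi> P R B" and ti: "tidy A \<phi> P D R B"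
    and c: "c \<in> VF - A" "par c \<in> A" and v: "v \<in> P" and y: "y \<in> A"
  shows "tidy (insert c A) (\<phi>(c := v)) (P - {v}) (D - {v})
    (insert {\<phi> (par c), v} R) (insert {\<phi> y, v} B)"
proof -
  have eq: "(\<phi>(c := v)) x = \<phi> x" if "x \<in> A" for x using that c by auto
  have old: "e \<in> R \<union> B" if "p \<in> P - {v}" "p \<in> e"
    "e \<in> insert {\<phi> (par c), v} R \<union> insert {\<phi> y, v} B" for p e
    using that pl c y by (auto simp: placed_def)
  show ?thesis
  proof (rule tidyI)
    show "D - {v} \<subseteq> P - {v}" using ti by (auto simp: tidy_def)
    fix p e assume p: "p \<in> P - {v}" "p \<in> e"
      and e: "e \<in> insert {\<phi> (par c), v} R \<union> insert {\<phi> y, v} B"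
    note * = tidy_edge[OF ti _ p(2) old[OF p e]]
    show "p \<in> D - {v}" using * p by auto
    show "\<exists>x\<in>insert c A. nonleaf x \<and> e = {p, (\<phi>(c := v)) x}"
      using * p eq by (metis DiffD1 insertCI)
    show "e = e'" if "p \<in> e'" "e' \<in> insert {\<phi> (par c), v} R \<union> insert {\<phi> y, v} B" for e'
      using tidy_edge_unique[OF ti _ p(2) that(1) old[OF p e] old[OF p(1) that]] p by auto
  qed
qed

text \<open>The sure move: the rejected \<open>w\<close> was clean, so its new blue edge is its only
  one, and it leads to a vertex with the child \<open>c\<close>.\<close>

lemma tidy_extend_spoil:
  assumes pl: "placed A \<phi> P R B" and ti: "tidy A \<phi> P D R B"
    and c: "c \<in> VF - A" "par c \<in> A" and v: "v \<in> P - D" and w: "w \<in> P - D" "v \<noteq> w"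
  shows "tidy (insert c A) (\<phi>(c := v)) (P - {v}) (insert w D)
    (insert {\<phi> (par c), v} R) (insert {\<phi> (par c), w} B)"
proof -
  have eq: "(\<phi>(c := v)) x = \<phi> x" if "x \<in> A" for x using that c by auto
  have nl: "nonleaf (par c)"
    using closed_Rt[OF placed_finite(3)[OF pl] c(1)] by (auto simp: nonleaf_def)
  let ?E = "insert {\<phi> (par c), v} R \<union> insert {\<phi> (par c), w} B"
  have old: "e \<in> R \<union> B \<and> p \<noteq> w \<or> p = w \<and> e = {p, \<phi> (par c)}"
    if p: "p \<in> P - {v}" "p \<in> e" and e: "e \<in> ?E" for p e
  proof (cases "e \<in> R \<union> B")
    case True
    then show ?thesis using tidy_edge(1)[OF ti _ p(2)] w p by auto
  next
    case False
    moreover have "\<phi> (par c) \<noteq> p" using p pl c by (auto simp: placed_def)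
    ultimately show ?thesis using p e by auto
  qed
  show ?thesis
  proof (rule tidyI)
    show "insert w D \<subseteq> P - {v}" using ti v w by (auto simp: tidy_def)
    fix p e assume p: "p \<in> P - {v}" "p \<in> e" and e: "e \<in> ?E"
    note * = tidy_edge[OF ti _ p(2)] and o = old[OF p e]
    show "p \<in> insert w D" using * o p by auto
    show "\<exists>x\<in>insert c A. nonleaf x \<and> e = {p, (\<phi>(c := v)) x}"
      using o
    proof
      assume "e \<in> R \<union> B \<and> p \<noteq> w"
      then show ?thesis using * p eq by (metis DiffD1 insertCI)
    next
      assume "p = w \<and> e = {p, \<phi> (par c)}"
      then show ?thesis using nl eq[OF c(2)] c by (metis insertCI)
    qed
    show "e = e'" if e': "p \<in> e'" "e' \<in> ?E" for e'
      using tidy_edge_unique[OF ti _ p(2) e'(1)] p o old[OF p(1) e'] by auto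
  qed
qed

lemma discard:
  assumes pl: "placed A \<phi> P R B" and ti: "tidy A \<phi> P D R B" and w: "w \<in> P"
  shows "placed A \<phi> (P - {w}) R B" "tidy A \<phi> (P - {w}) (D - {w}) R B"
proof -
  have wA: "w \<notin> \<phi> ` A" using pl w by (auto simp: placed_def)
  show "placed A \<phi> (P - {w}) R B"
  proof (rule placedI)
    show "parent_closed A" "inj_on \<phi> A" "\<phi> ` A \<subseteq> U \<union> V" "P - {w} \<subseteq> V" "\<phi> ` A \<inter> (P - {w}) = {}"
      "\<And>x. x \<in> Rt \<Longrightarrow> \<phi> x = pos x" "\<And>y. y \<in> A - Rt \<Longrightarrow> {\<phi> y, \<phi> (par y)} \<in> R"
      using pl by (auto simp: placed_def)
    show "e \<subseteq> \<phi> ` A \<union> (P - {w})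
          \<or> (\<exists>w' x. e = {w', \<phi> x} \<and> w' \<notin> \<phi> ` A \<union> (P - {w}) \<and> x \<in> A \<and> nonleaf x)"
      if e: "e \<in> R \<union> B" for e
    proof (cases "w \<in> e")
      case True
      show ?thesis using tidy_edge(2)[OF ti w True e] wA by blast
    next
      case False
      from pl e show ?thesis by (cases rule: placed_edge) (use False in blast)+
    qed
    show "e = e'" if w': "w' \<notin> \<phi> ` A \<union> (P - {w})" and e: "e \<in> R \<union> B" "e' \<in> R \<union> B"
      and we: "w' \<in> e" "w' \<in> e'" for w' e e'
    proof (cases "w' = w")
      case True
      then show ?thesis using tidy_edge_unique[OF ti w _ _ e] we by auto
    next
      case False
      then have "w' \<notin> \<phi> ` A \<union> P" using w' by blast
      then show ?thesis using placed_edge_unique[OF pl _ e we] by blast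
    qed
  qed
  show "tidy A \<phi> (P - {w}) (D - {w}) R B"
  proof (rule tidyI)
    show "D - {w} \<subseteq> P - {w}" using ti by (auto simp: tidy_def)
    fix p e assume p: "p \<in> P - {w}" "p \<in> e" and e: "e \<in> R \<union> B"
    show "p \<in> D - {w}" "\<exists>x\<in>A. nonleaf x \<and> e = {p, \<phi> x}"
      using tidy_edge[OF ti _ p(2) e] p by auto
    show "e = e'" if "p \<in> e'" "e' \<in> R \<union> B" for e'
      using tidy_edge_unique[OF ti _ p(2) that(1) e that(2)] p by auto
  qed
qed

subsection \<open>The endgame\<close>

text \<open>Covers the wasted round, in which edges are coloured but nothing is embedded.\<close>

lemma placed_add:
  assumes pl: "placed A \<phi> P R B" and e: "e \<subseteq> \<phi> ` A \<union> P" "f \<subseteq> \<phi> ` A \<union> P"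
  shows "placed A \<phi> P (insert e R) (insert f B)"
proof (rule placedI)
  show "parent_closed A" "inj_on \<phi> A" "\<phi> ` A \<subseteq> U \<union> V" "P \<subseteq> V" "\<phi> ` A \<inter> P = {}"
    "\<And>x. x \<in> Rt \<Longrightarrow> \<phi> x = pos x" "\<And>y. y \<in> A - Rt \<Longrightarrow> {\<phi> y, \<phi> (par y)} \<in> insert e R"
    using pl by (auto simp: placed_def)
  show "d \<subseteq> \<phi> ` A \<union> P \<or> (\<exists>w x. d = {w, \<phi> x} \<and> w \<notin> \<phi> ` A \<union> P \<and> x \<in> A \<and> nonleaf x)"
    if "d \<in> insert e R \<union> insert f B" for d
  proof (cases "d \<in> R \<union> B")
    case True
    with pl show ?thesis by (cases rule: placed_edge) blast+
  next
    case False
    then have "d = e \<or> d = f" using that by blast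
    then show ?thesis using e by metis
  qed
  show "d = d'" if w: "w \<notin> \<phi> ` A \<union> P"
    and d: "d \<in> insert e R \<union> insert f B" "d' \<in> insert e R \<union> insert f B" "w \<in> d" "w \<in> d'" for w d d'
  proof -
    have "a \<in> R \<union> B" if "a \<in> insert e R \<union> insert f B" "w \<in> a" for a
      using that e w by blast
    then show ?thesis using placed_edge_unique[OF pl w] d by metis
  qed
qed

text \<open>The leaf \<open>l\<close> moves to \<open>p\<close> and \<open>c\<close> takes its old
  place. As \<open>l\<close> has no children, only its own parent edge has to be replaced.\<close>

lemma placed_swap:
  assumes pl: "placed A \<phi> {p} R B" and c: "VF - A = {c}" "par c \<in> A"
    and l: "l \<in> A - Rt" "\<not> nonleaf l"
    and red: "{\<phi> (par l), p} \<in> R" "{\<phi> (par c), \<phi> l} \<in> R"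
  shows "placed VF (\<phi>(l := p, c := \<phi> l)) {} R B"
proof -
  let ?\<psi> = "\<phi>(l := p, c := \<phi> l)"
  have A: "parent_closed A" by (rule placed_finite(3)[OF pl])
  have cA: "c \<in> VF" "c \<notin> A" using c by auto
  have VF: "VF = insert c A" using c closed_subset[OF A] by auto
  have lc: "l \<noteq> c" using l cA by auto
  have p: "p \<notin> \<phi> ` A" using pl by (auto simp: placed_def)
  have inj: "inj_on \<phi> A" using pl by (simp add: placed_def)
  have eq: "?\<psi> x = \<phi> x" if "x \<in> A" "x \<noteq> l" for x using that cA by auto
  have par: "par y \<in> A \<and> par y \<noteq> l" if "y \<in> VF - Rt" for y
  proof -
    have "y = c \<or> y \<in> A - Rt" using that VF by blast
    then have "par y \<in> A" using A c(2) by (auto simp: parent_closed_def)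
    then show ?thesis using that l by (auto simp: nonleaf_def)
  qed
  have same: "?\<psi> ` VF \<union> {} = \<phi> ` A \<union> {p}"
    unfolding VF using cA l by auto
  show ?thesis
  proof (rule placedI, unfold same)
    show "parent_closed VF" using Rt_VF par_VF by (auto simp: parent_closed_def)
    have eqA: "?\<psi> x = (\<phi>(l := p)) x" if "x \<in> A" for x
      using that cA by auto
    have "inj_on (\<phi>(l := p)) A"
      using inj p by (auto simp: inj_on_def)
    then have 1: "inj_on ?\<psi> A"
      using inj_on_cong[of A ?\<psi> "\<phi>(l := p)"] eqA by blast
    have 2: "?\<psi> ` A = (\<phi>(l := p)) ` A"
      by (rule image_cong[OF refl]) (rule eqA)
    have "\<phi> l \<notin> (\<phi>(l := p)) ` A"
      using inj l p by (auto simp: inj_on_def)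
    then have 3: "?\<psi> c \<notin> ?\<psi> ` A" unfolding 2 by simp
    have "A - {c} = A" using cA by blast
    then show "inj_on ?\<psi> VF"
      unfolding VF inj_on_insert using 1 3 by metis
    show "?\<psi> ` VF \<subseteq> U \<union> V" using same pl by (auto simp: placed_def)
    show "?\<psi> x = pos x" if "x \<in> Rt" for x
    proof -
      have "x \<in> A" "x \<noteq> l" using that A l by (auto simp: parent_closed_def)
      then show ?thesis using eq pl that by (simp add: placed_def)
    qed
    show "{?\<psi> y, ?\<psi> (par y)} \<in> R" if y: "y \<in> VF - Rt" for y
    proof -
      have *: "?\<psi> (par y) = \<phi> (par y)" using eq par[OF y] by blast
      consider "y = c" | "y = l" | "y \<in> A - Rt" "y \<noteq> l" using y VF by auto
      then show ?thesis
      proof cases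
        case 1
        then show ?thesis using * red by (simp add: insert_commute)
      next
        case 2
        then show ?thesis using * red lc by (simp add: insert_commute)
      next
        case 3
        then have "?\<psi> y = \<phi> y" using eq by auto
        then show ?thesis using * pl 3 by (simp add: placed_def)
      qed
    qed
    show "e \<subseteq> \<phi> ` A \<union> {p}
      \<or> (\<exists>w x. e = {w, ?\<psi> x} \<and> w \<notin> \<phi> ` A \<union> {p} \<and> x \<in> VF \<and> nonleaf x)"
      if e: "e \<in> R \<union> B" for e
      using pl e
    proof (cases rule: placed_edge)
      case (2 w x)
      then have "?\<psi> x = \<phi> x" using eq[of x] l by auto
      then show ?thesis using 2 VF by (metis insertCI)
    qed auto
    show "e = e'" if "w \<notin> \<phi> ` A \<union> {p}" "e \<in> R \<union> B" "e' \<in> R \<union> B" "w \<in> e" "w \<in> e'" for w e e'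
      using placed_edge_unique[OF pl that] .
  qed auto
qed

text \<open>If Client colours the edge to \<open>p\<close> red, \<open>c\<close> goes to
  \<open>p\<close>; otherwise \<open>c\<close> takes the place of \<open>l\<close>, and
  \<open>l\<close> moves to \<open>p\<close> along the edge that is red already.\<close>

lemma wins_last_choice:
  assumes pl: "placed A \<phi> {p} R B" and c: "VF - A = {c}" "par c \<in> A"
    and l: "l \<in> A - Rt" "\<not> nonleaf l" "\<phi> l \<in> V" "{\<phi> (par l), p} \<in> R"
    and free: "{\<phi> (par c), p} \<notin> R \<union> B" "{\<phi> (par c), \<phi> l} \<notin> R \<union> B"
  shows "wins 1 R B"
proof -
  have A: "parent_closed A" by (rule placed_finite(3)[OF pl])
  have pV: "p \<in> V" and pA: "p \<notin> \<phi> ` A" and inj: "inj_on \<phi> A"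
    using pl by (auto simp: placed_def)
  have cl: "c \<in> VF - A" "par c \<noteq> l"
    using c l closed_Rt[OF A, of c] by (auto simp: nonleaf_def)
  have ne: "\<phi> (par c) \<noteq> \<phi> l" "\<phi> (par c) \<noteq> p" "\<phi> l \<noteq> p"
    using inj c l cl pA by (auto simp: inj_on_def)
  have sub: "{\<phi> (par c), \<phi> l} \<subseteq> \<phi> ` A \<union> {p}" "{\<phi> (par c), p} \<subseteq> \<phi> ` A \<union> {p}"
    using c l by auto
  have VF: "insert c A = VF" using c closed_subset[OF A] by auto
  have w1: "wins 0 (insert {\<phi> (par c), p} R) (insert {\<phi> (par c), \<phi> l} B)"
    using placed_extend[OF pl cl(1) c(2) _ sub(1), of p] unfolding VF
    by (intro waiter_wins_goal) auto
  have w2: "wins 0 (insert {\<phi> (par c), \<phi> l} R) (insert {\<phi> (par c), p} B)"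
    using placed_swap[OF placed_add[OF pl sub] c l(1,2)] l(4) by (intro waiter_wins_goal) auto
  have "{\<phi> (par c), p} \<noteq> {\<phi> (par c), \<phi> l}"
    using ne by (auto simp: doubleton_eq_iff)
  then show ?thesis
    using wins_offer[OF pl c(2) c(2) pV l(3) _ ne(2,1) free w1 w2] by simp
qed

text \<open>\<open>p\<close> is kept in reserve, \<open>S\<close> collects leaves that may be exchanged for \<open>p\<close> in the last round,
  and only the parents of \<open>X\<close> may have coloured edges to the pool.\<close>

definition ready :: "'a set \<Rightarrow> ('a \<Rightarrow> 'b) \<Rightarrow> 'b set \<Rightarrow> 'b set set \<Rightarrow> 'b set set \<Rightarrow> 'b \<Rightarrow> 'a set \<Rightarrow> 'a set \<Rightarrow> bool"
  where
  "ready A \<phi> P R B p S X \<longleftrightarrow> placed A \<phi> P R B \<and> card (VF - A) = card P \<and> p \<in> P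
    \<and> inj_on par ((VF - A) \<union> S) \<and> par ` (VF - A) \<subseteq> A
    \<and> S \<subseteq> A - Rt \<and> (\<forall>l\<in>S. \<not> nonleaf l \<and> \<phi> l \<in> V \<and> {\<phi> (par l), p} \<notin> R \<union> B)
    \<and> (\<forall>c\<in>VF - A - X. \<forall>v\<in>P \<union> \<phi> ` S. {\<phi> (par c), v} \<notin> R \<union> B)"

section \<open>Endgame moves that keep a reserve vertex\<close>

lemma readyD:
  assumes "ready A \<phi> P R B p S X"
  shows "placed A \<phi> P R B" "card (VF - A) = card P" "p \<in> P" "inj_on par ((VF - A) \<union> S)"
    "par ` (VF - A) \<subseteq> A" "S \<subseteq> A - Rt"
    "l \<in> S \<Longrightarrow> \<not> nonleaf l \<and> \<phi> l \<in> V \<and> {\<phi> (par l), p} \<notin> R \<union> B"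
    "c \<in> VF - A - X \<Longrightarrow> v \<in> P \<union> \<phi> ` S \<Longrightarrow> {\<phi> (par c), v} \<notin> R \<union> B"
  using assms unfolding ready_def by blast+

lemma readyI:
  assumes "placed A \<phi> P R B" "card (VF - A) = card P" "p \<in> P" "inj_on par ((VF - A) \<union> S)"
    "par ` (VF - A) \<subseteq> A" "S \<subseteq> A - Rt"
    "\<And>l. l \<in> S \<Longrightarrow> \<not> nonleaf l \<and> \<phi> l \<in> V \<and> {\<phi> (par l), p} \<notin> R \<union> B"
    "\<And>c v. c \<in> VF - A - X \<Longrightarrow> v \<in> P \<union> \<phi> ` S \<Longrightarrow> {\<phi> (par c), v} \<notin> R \<union> B"
  shows "ready A \<phi> P R B p S X"
  unfolding ready_def using assms by blast

text \<open>Common part of both endgame moves: \<open>S'\<close> records whether \<open>c\<close>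
  becomes exchangeable, \<open>f1\<close> and \<open>f2\<close> say that the blue edge spoils none
  of the edges kept free. The exceptional set \<open>X\<close> becomes empty, since its only
  possible member \<open>c\<close> is now embedded.\<close>

lemma ready_extend:
  assumes re: "ready A \<phi> P R B p S X" and c: "c \<in> VF - A" "X \<subseteq> {c}" and v: "v \<in> P" "v \<noteq> p"
    and f: "f \<subseteq> \<phi> ` A \<union> P"
    and S': "S' = S \<or> S' = insert c S \<and> {\<phi> (par c), p} \<notin> R \<union> B"
    and f1: "\<And>d u. d \<in> VF - A - {c} \<Longrightarrow> u \<in> (P - {v}) \<union> \<phi> ` S \<union> (if S' = S then {} else {v})
              \<Longrightarrow> f \<noteq> {\<phi> (par d), u}"
    and f2: "\<And>l. l \<in> S' \<Longrightarrow> f \<noteq> {\<phi> (par l), p}"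
  shows "ready (insert c A) (\<phi>(c := v)) (P - {v}) (insert {\<phi> (par c), v} R) (insert f B) p S' {}"
proof -
  have pl: "placed A \<phi> P R B" and card: "card (VF - A) = card P" and p: "p \<in> P"
    and inj: "inj_on par ((VF - A) \<union> S)" and parA: "par ` (VF - A) \<subseteq> A" and S: "S \<subseteq> A - Rt"
    and leaf: "\<And>l. l \<in> S \<Longrightarrow> \<not> nonleaf l \<and> \<phi> l \<in> V \<and> {\<phi> (par l), p} \<notin> R \<union> B"
    and free: "\<And>c v. c \<in> VF - A - X \<Longrightarrow> v \<in> P \<union> \<phi> ` S \<Longrightarrow> {\<phi> (par c), v} \<notin> R \<union> B"
    using readyD[OF re] by simp_all
  have A: "parent_closed A" by (rule placed_finite(3)[OF pl])
  have injA: "inj_on \<phi> A" and disj: "\<phi> ` A \<inter> P = {}" and PV: "P \<subseteq> V"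
    using pl by (auto simp: placed_def)
  have pc: "par c \<in> A" using parA c by auto
  have cR: "c \<notin> Rt" using closed_Rt[OF A c(1)] by simp
  have eq: "(\<phi>(c := v)) x = \<phi> x" if "x \<in> A" for x using that c by auto
  \<comment> \<open>An embedded child would force \<open>c\<close> into the parent-closed
    \<open>A\<close>; a missing child would have the non-embedded parent \<open>c\<close>.\<close>
  have leafc: "\<not> nonleaf c"
  proof
    assume "nonleaf c"
    then obtain y where y: "y \<in> VF - Rt" "par y = c" using cR by (auto simp: nonleaf_def)
    show False
    proof (cases "y \<in> A")
      case True
      then show False using y A c by (auto simp: parent_closed_def)
    next
      case False
      then show False using y parA c by auto
    qed
  qed
  have Spar: "par l \<in> A" if "l \<in> S" for l using that S A by (auto simp: parent_closed_def)
  have S'sub: "S' \<subseteq> insert c S" using S' by auto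
  have S'par: "par l \<in> A" if "l \<in> S'" for l using that S'sub Spar pc by auto
  have r1: "card (VF - insert c A) = card (P - {v})"
  proof -
    have "VF - insert c A = (VF - A) - {c}" by auto
    then show ?thesis using card c v by simp
  qed
  have r2: "inj_on par ((VF - insert c A) \<union> S')"
    by (rule inj_on_subset[OF inj]) (use S'sub c in auto)
  have r3: "par ` (VF - insert c A) \<subseteq> insert c A" using parA by auto
  have r4: "S' \<subseteq> insert c A - Rt" using S S'sub cR by auto
  have r5: "\<not> nonleaf l \<and> (\<phi>(c := v)) l \<in> V \<and>
      {(\<phi>(c := v)) (par l), p} \<notin> insert {\<phi> (par c), v} R \<union> insert f B" if l: "l \<in> S'" for l
  proof -
    have 1: "(\<phi>(c := v)) (par l) = \<phi> (par l)" using eq S'par[OF l] by blast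
    have "\<phi> (par l) \<noteq> v" using S'par[OF l] disj v by auto
    then have 2: "{\<phi> (par l), p} \<noteq> {\<phi> (par c), v}" using v by (auto simp: doubleton_eq_iff)
    have 3: "{\<phi> (par l), p} \<noteq> f" using f2[OF l] by metis
    have 4: "{\<phi> (par l), p} \<notin> R \<union> B"
      using S' leaf l by auto
    have 5: "\<not> nonleaf l \<and> (\<phi>(c := v)) l \<in> V"
      using l S'sub leaf leafc v PV by auto
    show ?thesis unfolding 1 using 2 3 4 5 by blast
  qed
  have r6: "{(\<phi>(c := v)) (par d), u} \<notin> insert {\<phi> (par c), v} R \<union> insert f B"
    if d: "d \<in> VF - insert c A - {}" and u: "u \<in> (P - {v}) \<union> (\<phi>(c := v)) ` S'" for d u
  proof -
    have dA: "d \<in> VF - A - {c}" using d by auto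
    have pd: "par d \<in> A" using parA d by auto
    have 1: "(\<phi>(c := v)) (par d) = \<phi> (par d)" by (rule eq[OF pd])
    have ne: "par d \<noteq> par c" using inj d c by (auto simp: inj_on_def)
    have "\<phi> (par d) \<noteq> \<phi> (par c)" "\<phi> (par d) \<noteq> v"
      using ne pd pc injA disj v by (auto simp: inj_on_def)
    then have 2: "{\<phi> (par d), u} \<noteq> {\<phi> (par c), v}" by (auto simp: doubleton_eq_iff)
    have cS: "c \<notin> S" using S c by auto
    have SA: "(\<phi>(c := v)) ` S = \<phi> ` S" by (rule image_cong[OF refl]) (use S eq in blast)
    have u': "u \<in> (P - {v}) \<union> \<phi> ` S \<union> (if S' = S then {} else {v})"
      using u S' cS SA by auto
    have 3: "{\<phi> (par d), u} \<noteq> f" using f1[OF dA u'] by metis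
    have "u \<in> P \<union> \<phi> ` S" using u' v by (auto split: if_splits)
    then have 4: "{\<phi> (par d), u} \<notin> R \<union> B" using free dA c(2) by blast
    show ?thesis unfolding 1 using 2 3 4 by blast
  qed
  have r7: "p \<in> P - {v}" using p v by simp
  show ?thesis
    by (rule readyI) (fact placed_extend[OF pl c(1) pc v(1) f] r1 r7 r2 r3 r4 r5 r6)+
qed

text \<open>The blue edge starts at the parent of \<open>c\<close>, which no other missing vertex
  shares, and avoids \<open>p\<close>. So \<open>c\<close> may join the exchangeable leaves.\<close>

lemma ready_sure:
  assumes re: "ready A \<phi> P R B p S X" and c: "c \<in> VF - A" "X \<subseteq> {c}"
    and v: "v \<in> P - {p}" "w \<in> P - {p}" and free: "{\<phi> (par c), p} \<notin> R \<union> B"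
  shows "ready (insert c A) (\<phi>(c := v)) (P - {v}) (insert {\<phi> (par c), v} R)
    (insert {\<phi> (par c), w} B) p (insert c S) {}"
proof (rule ready_extend[OF re c])
  have pl: "placed A \<phi> P R B" and inj: "inj_on par ((VF - A) \<union> S)"
    and parA: "par ` (VF - A) \<subseteq> A" and S: "S \<subseteq> A - Rt"
    using re by (auto simp: ready_def)
  have A: "parent_closed A" by (rule placed_finite(3)[OF pl])
  have injA: "inj_on \<phi> A" and disj: "\<phi> ` A \<inter> P = {}"
    using pl by (auto simp: placed_def)
  have pc: "par c \<in> A" using parA c by auto
  show "{\<phi> (par c), w} \<subseteq> \<phi> ` A \<union> P" using pc v by auto
  show "{\<phi> (par c), w} \<noteq> {\<phi> (par d), u}" if "d \<in> VF - A - {c}" for d u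
  proof -
    have "par d \<noteq> par c" "par d \<in> A" using inj that c parA by (auto simp: inj_on_def)
    then have "\<phi> (par d) \<noteq> \<phi> (par c)" "\<phi> (par d) \<noteq> w"
      using pc injA disj v by (auto simp: inj_on_def)
    then show ?thesis by (auto simp: doubleton_eq_iff)
  qed
  show "{\<phi> (par c), w} \<noteq> {\<phi> (par l), p}" if "l \<in> insert c S" for l
  proof -
    have "par l \<in> A" using that S A pc by (auto simp: parent_closed_def)
    then have "\<phi> (par l) \<noteq> w" using disj v by auto
    then show ?thesis using v by (auto simp: doubleton_eq_iff)
  qed
qed (use v free in auto)

text \<open>The blue edge ends in \<open>v\<close>, which leaves the pool. Since \<open>v\<close> is
  now blocked for the parent of \<open>c'\<close>, the leaf \<open>c\<close> is not made
  exchangeable.\<close>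

lemma ready_pair:
  assumes re: "ready A \<phi> P R B p S {}" and c: "c \<in> VF - A" "c' \<in> VF - A" and v: "v \<in> P - {p}"
  shows "ready (insert c A) (\<phi>(c := v)) (P - {v}) (insert {\<phi> (par c), v} R)
    (insert {\<phi> (par c'), v} B) p S {}"
proof (rule ready_extend[OF re c(1)])
  have pl: "placed A \<phi> P R B" and parA: "par ` (VF - A) \<subseteq> A" and S: "S \<subseteq> A - Rt"
    using re by (auto simp: ready_def)
  have A: "parent_closed A" by (rule placed_finite(3)[OF pl])
  have disj: "\<phi> ` A \<inter> P = {}" using pl by (auto simp: placed_def)
  show "{\<phi> (par c'), v} \<subseteq> \<phi> ` A \<union> P" using parA c v by auto
  show "{\<phi> (par c'), v} \<noteq> {\<phi> (par d), u}"
    if "d \<in> VF - A - {c}" "u \<in> P - {v} \<union> \<phi> ` S \<union> (if S = S then {} else {v})" for d u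
  proof -
    have "par d \<in> A" using that parA by auto
    then have "\<phi> (par d) \<noteq> v" "u \<noteq> v" using that disj v S by auto
    then show ?thesis by (auto simp: doubleton_eq_iff)
  qed
  show "{\<phi> (par c'), v} \<noteq> {\<phi> (par l), p}" if "l \<in> S" for l
  proof -
    have "par l \<in> A" using that S A by (auto simp: parent_closed_def)
    then have "\<phi> (par l) \<noteq> v" using disj v by auto
    then show ?thesis using v by (auto simp: doubleton_eq_iff)
  qed
qed (use v in auto)

text \<open>The round count is \<open>card P - 1\<close> pair moves, one wasted round and one last
  choice.\<close>

lemma wins_ready_pairs:
  assumes "ready A \<phi> P R B p {c0, c1} {}" and "c0 \<noteq> c1"
  shows "wins (Suc (card P)) R B"
  using assms(1)
proof (induction "card P" arbitrary: A \<phi> P R B rule: less_induct)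
  case less
  let ?S = "{c0, c1}"
  have pl: "placed A \<phi> P R B" and card: "card (VF - A) = card P" and p: "p \<in> P"
    and inj: "inj_on par ((VF - A) \<union> ?S)" and parA: "par ` (VF - A) \<subseteq> A" and S: "?S \<subseteq> A - Rt"
    and leaf: "\<And>l. l \<in> ?S \<Longrightarrow> \<not> nonleaf l \<and> \<phi> l \<in> V \<and> {\<phi> (par l), p} \<notin> R \<union> B"
    and free: "\<And>c v. c \<in> VF - A \<Longrightarrow> v \<in> P \<union> \<phi> ` ?S \<Longrightarrow> {\<phi> (par c), v} \<notin> R \<union> B"
    using readyD[OF less.prems] by simp_all
  have A: "parent_closed A" and finP: "finite P" using placed_finite[OF pl] by auto
  have injA: "inj_on \<phi> A" and disj: "\<phi> ` A \<inter> P = {}" and PV: "P \<subseteq> V"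
    using pl by (auto simp: placed_def)
  have pos: "card P > 0" using p finP by (auto simp: card_gt_0_iff)
  show ?case
  proof (cases "card P = 1")
    case True
    then have P: "P = {p}" using p by (auto simp: card_1_singleton_iff)
    obtain c where c: "VF - A = {c}" using card True by (auto simp: card_1_singleton_iff)
    have pc: "par c \<in> A" using parA c by auto
    have parS: "par l \<in> A" if "l \<in> ?S" for l using that S A by (auto simp: parent_closed_def)
    have pneq: "p \<noteq> \<phi> x" if "x \<in> A" for x using that disj P by auto
    have ne: "\<phi> (par c) \<noteq> \<phi> (par l)" if "l \<in> ?S" for l
    proof -
      have "l \<noteq> c" using that S c by auto
      then have "par l \<noteq> par c" using inj that c by (auto simp: inj_on_def)
      then show ?thesis using injA parS[OF that] pc by (auto simp: inj_on_def)
    qed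
    \<comment> \<open>Here \<open>l\<close> is the leaf that \<open>p\<close> can now replace. The
      wasted round does not touch the edges needed at the parent of \<open>c\<close>, because that
      parent differs from those of \<open>l\<close> and \<open>l'\<close>.\<close>
    have step: "wins 1 (insert {\<phi> (par l), p} R) (insert {\<phi> (par l'), p} B)"
      if l: "l \<in> ?S" and l': "l' \<in> ?S" for l l'
    proof (rule wins_last_choice[where c = c and l = l])
      have pl': "placed A \<phi> {p} R B" using pl P by simp
      show "placed A \<phi> {p} (insert {\<phi> (par l), p} R) (insert {\<phi> (par l'), p} B)"
        by (rule placed_add[OF pl']) (use parS l l' in auto)
      have d: "{\<phi> (par c), v} \<noteq> {\<phi> (par k), p}" if "k \<in> ?S" for v k
        using ne[OF that] pneq[OF pc] by (auto simp: doubleton_eq_iff)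
      show "{\<phi> (par c), p} \<notin> insert {\<phi> (par l), p} R \<union> insert {\<phi> (par l'), p} B"
        using free[of c p] d[OF l] d[OF l'] c p by auto
      show "{\<phi> (par c), \<phi> l} \<notin> insert {\<phi> (par l), p} R \<union> insert {\<phi> (par l'), p} B"
        using free[of c "\<phi> l"] d[OF l] d[OF l'] c l by blast
    qed (use c pc S l leaf[OF l] in auto)
    have "par c0 \<noteq> par c1" using inj assms(2) by (auto simp: inj_on_def)
    then have "\<phi> (par c0) \<noteq> \<phi> (par c1)" using injA parS by (auto simp: inj_on_def)
    then have "{\<phi> (par c0), p} \<noteq> {\<phi> (par c1), p}" by (auto simp: doubleton_eq_iff)
    then have "wins (Suc 1) R B"
      using leaf[of c0] leaf[of c1] p PV
      by (intro wins_offer[OF pl parS[of c0] parS[of c1] _ _ _ _ _ _ _ step step])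
        (use pneq parS in \<open>auto dest: not_sym\<close>)
    then show ?thesis using True by simp
  next
    case False
    then have two: "card (VF - A) \<ge> 2" and "card (P - {p}) \<ge> 1" using card pos p by auto
    then obtain v where v: "v \<in> P - {p}" by (metis card.empty ex_in_conv not_one_le_zero)
    obtain c c' where c: "c \<in> VF - A" "c' \<in> VF - A" "c \<noteq> c'"
      using two by (metis card_2_iff insert_subset obtain_subset_with_card_n)
    have less': "card (P - {v}) < card P" and Suc: "Suc (card (P - {v})) = card P"
      using v finP pos by auto
    have step: "wins (card P) (insert {\<phi> (par c), v} R) (insert {\<phi> (par c'), v} B)"
      if "c \<in> VF - A" "c' \<in> VF - A" for c c'
      using less.hyps[OF less' ready_pair[OF less.prems that v]] unfolding Suc .
    have pc: "par c \<in> A" "par c' \<in> A" using c parA by auto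
    have "par c \<noteq> par c'" using inj c by (auto simp: inj_on_def)
    then have "\<phi> (par c) \<noteq> \<phi> (par c')" using injA pc by (auto simp: inj_on_def)
    then have "{\<phi> (par c), v} \<noteq> {\<phi> (par c'), v}" by (auto simp: doubleton_eq_iff)
    then show ?thesis
      by (intro wins_offer[OF pl pc _ _ _ _ _ _ _ step[OF c(1,2)] step[OF c(2,1)]])
        (use v pc PV disj free c in auto)
  qed
qed

lemma wins_sure:
  assumes pl: "placed A \<phi> P R B" and x: "x \<in> A" and v: "v \<in> P" "w \<in> P" "v \<noteq> w"
    and free: "{\<phi> x, v} \<notin> R \<union> B" "{\<phi> x, w} \<notin> R \<union> B"
    and "\<And>v w. v \<in> P' \<Longrightarrow> w \<in> P' \<Longrightarrow> v \<noteq> w \<Longrightarrow> wins n (insert {\<phi> x, v} R) (insert {\<phi> x, w} B)"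
    and "v \<in> P'" "w \<in> P'"
  shows "wins (Suc n) R B"
proof -
  have "\<phi> x \<noteq> v" "\<phi> x \<noteq> w" "v \<in> V" "w \<in> V" "{\<phi> x, v} \<noteq> {\<phi> x, w}"
    using pl x v by (auto simp: placed_def doubleton_eq_iff)
  then show ?thesis
    using free assms(8)[OF assms(9,10) v(3)] assms(8)[OF assms(10,9) v(3)[symmetric]]
    by (intro wins_offer[OF pl x x])
qed

text \<open>Four pool vertices, at most one of them dirty, leave three clean ones: the reserve
  \<open>p\<close> and two for the first sure move. After it, two vertices besides \<open>p\<close>
  remain for the second.\<close>

lemma wins_endgame:
  assumes pl: "placed A \<phi> P R B" and ti: "tidy A \<phi> P D R B"
    and card: "card (VF - A) = card P" "card P \<ge> 4" "card D \<le> 1"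
    and res: "\<And>x. x \<in> A \<Longrightarrow> residual A x \<le> 1"
  shows "wins (Suc (card P)) R B"
proof -
  have A: "parent_closed A" and finP: "finite P" using placed_finite[OF pl] by auto
  have injA: "inj_on \<phi> A" and disj: "\<phi> ` A \<inter> P = {}" and PV: "P \<subseteq> V"
    using pl by (auto simp: placed_def)
  have DP: "D \<subseteq> P" using ti by (simp add: tidy_def)
  then have finD: "finite D" using finP finite_subset by blast
  have parA: "par ` (VF - A) \<subseteq> A" and inj: "inj_on par (VF - A)"
    using residual_le_one[OF A res] by auto
  have clean: "{a, v} \<notin> R \<union> B" if "v \<in> P - D" for a v
    using tidy_edge(1)[OF ti, of v "{a, v}"] that by auto
  \<comment> \<open>The only possible dirty vertex has at most one coloured edge, so it obstructs at
    most one missing leaf. That leaf \<open>c0\<close> is attached first, using clean vertices;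
    afterwards every remaining parent sees the whole pool free.\<close>
  have "\<exists>c0\<in>VF - A. \<forall>c\<in>VF - A - {c0}. \<forall>v\<in>P. {\<phi> (par c), v} \<notin> R \<union> B"
  proof (cases "\<exists>c\<in>VF - A. \<exists>v\<in>P. {\<phi> (par c), v} \<in> R \<union> B")
    case True
    then obtain c0 v0 where c0: "c0 \<in> VF - A" "v0 \<in> P" "{\<phi> (par c0), v0} \<in> R \<union> B" by blast
    have "{\<phi> (par c), v} \<notin> R \<union> B" if c: "c \<in> VF - A - {c0}" "v \<in> P" for c v
    proof
      assume e: "{\<phi> (par c), v} \<in> R \<union> B"
      have "v \<in> D" "v0 \<in> D" using clean e c0 c by blast+
      then have "v = v0" using card(3) finD by (auto simp: card_le_Suc0_iff_eq)
      then have "{\<phi> (par c), v} = {\<phi> (par c0), v}"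
        using tidy_edge_unique[OF ti c(2) _ _ e] c0 by auto
      then have "\<phi> (par c) = \<phi> (par c0)" by (auto simp: doubleton_eq_iff)
      then have "par c = par c0" using injA parA c c0 by (auto simp: inj_on_def)
      then show False using inj c c0 by (auto simp: inj_on_def)
    qed
    then show ?thesis using c0 by blast
  next
    case False
    moreover have "VF - A \<noteq> {}"
      using card(1,2) by (metis card.empty not_numeral_le_zero)
    ultimately show ?thesis by blast
  qed
  then obtain c0 where c0: "c0 \<in> VF - A"
    and free: "\<And>c v. c \<in> VF - A - {c0} \<Longrightarrow> v \<in> P \<Longrightarrow> {\<phi> (par c), v} \<notin> R \<union> B" by blast
  have "card (P - D) \<ge> 3" using card DP finD by (simp add: card_Diff_subset)
  then obtain T where "T \<subseteq> P - D" "card T = 3" by (meson obtain_subset_with_card_n)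
  then obtain p v w where p: "p \<in> P - D" and v: "v \<in> P - D - {p}" and w: "w \<in> P - D - {p}" "v \<noteq> w"
    by (auto simp: card_3_iff)
  have ready0: "ready A \<phi> P R B p {} {c0}"
    using pl card p inj parA free unfolding ready_def by auto
  have step: "wins (card P) (insert {\<phi> (par c0), v} R) (insert {\<phi> (par c0), w} B)"
    if v: "v \<in> P - D - {p}" and w: "w \<in> P - D - {p}" "v \<noteq> w" for v w
  proof -
    let ?A = "insert c0 A" and ?\<phi> = "\<phi>(c0 := v)" and ?P = "P - {v}"
    let ?R = "insert {\<phi> (par c0), v} R" and ?B = "insert {\<phi> (par c0), w} B"
    have re: "ready ?A ?\<phi> ?P ?R ?B p {c0} {}"
      using ready_sure[OF ready0 c0 _ _ _ clean] v w p by auto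
    note pl1 = readyD(1)[OF re] and card1 = readyD(2)[OF re] and p1 = readyD(3)[OF re]
      and par1 = readyD(5)[OF re]
    have free1: "{?\<phi> (par c), v} \<notin> ?R \<union> ?B" if "c \<in> VF - ?A" "v \<in> ?P" for c v
      by (rule readyD(8)[OF re]) (use that in auto)
    have three: "card ?P \<ge> 3" and Suc: "Suc (card ?P) = card P" using card v finP by auto
    have "card (?P - {p}) \<ge> 2" using three p1 finP by simp
    then obtain T where "T \<subseteq> ?P - {p}" "card T = 2" by (meson obtain_subset_with_card_n)
    then obtain a b where ab: "a \<in> ?P - {p}" "b \<in> ?P - {p}" "a \<noteq> b" by (auto simp: card_2_iff)
    have "VF - ?A \<noteq> {}"
      using card1 three by (metis card.empty not_numeral_le_zero)
    then obtain c1 where c1: "c1 \<in> VF - ?A" by blast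
    have pc1: "par c1 \<in> ?A" using par1 c1 by auto
    have "wins (Suc (card ?P)) ?R ?B"
    proof (rule wins_sure[OF pl1 pc1 _ _ ab(3), where P' = "?P - {p}"])
      fix a b assume ab: "a \<in> ?P - {p}" "b \<in> ?P - {p}" "a \<noteq> b"
      have "ready (insert c1 ?A) (?\<phi>(c1 := a)) (?P - {a}) (insert {?\<phi> (par c1), a} ?R)
          (insert {?\<phi> (par c1), b} ?B) p {c1, c0} {}"
        by (rule ready_sure[OF re c1 _ ab(1,2) free1[OF c1 p1]]) simp
      then have "wins (Suc (card (?P - {a}))) (insert {?\<phi> (par c1), a} ?R)
          (insert {?\<phi> (par c1), b} ?B)"
        by (rule wins_ready_pairs) (use c1 in auto)
      moreover have "Suc (card (?P - {a})) = card ?P"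
        using ab finP by (intro card_Suc_Diff1) auto
      ultimately show "wins (card ?P) (insert {?\<phi> (par c1), a} ?R) (insert {?\<phi> (par c1), b} ?B)"
        by metis
    qed (use ab free1[OF c1] in auto)
    then show ?thesis unfolding Suc .
  qed
  show ?thesis
    by (rule wins_sure[OF pl _ _ _ w(2), where x = "par c0" and P' = "P - D - {p}"])
      (use parA c0 v w clean step in auto)
qed

subsection \<open>Balancing the residual trees\<close>

definition maximal :: "'a set \<Rightarrow> nat \<Rightarrow> 'a set" where
  "maximal A M = {x \<in> A. residual A x = M}"

text \<open>As long as some pool vertex is dirty, the slack of the hypothesis is preserved. With a clean pool,
  one pair move for each but one maximal tree and one sure move at the last one lower the bound \<open>M\<close>
  by one; this is what the term \<open>min _ 3\<close> pays for.\<close>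

definition balanced :: "'a set \<Rightarrow> 'b set \<Rightarrow> 'b set \<Rightarrow> nat \<Rightarrow> bool" where
  "balanced A P D M \<longleftrightarrow> card (VF - A) \<le> card P \<and> (\<forall>x\<in>A. residual A x \<le> M)
    \<and> (D \<noteq> {} \<longrightarrow> 3 * M + card D \<le> card P)
    \<and> (D = {} \<longrightarrow> 3 * M + min (card (maximal A M)) 3 \<le> card P + 2)"

text \<open>Both parts of the divided tree are smaller than \<open>M\<close>, so
  \<open>par c\<close> stops being maximal and \<open>c\<close> does not start.\<close>

lemma maximal_insert:
  assumes A: "parent_closed A" and c: "c \<in> VF - A" "par c \<in> A" and le: "\<forall>x\<in>A. residual A x \<le> M"
  shows "\<forall>x\<in>insert c A. residual (insert c A) x \<le> M"
    and "maximal (insert c A) M = maximal A M - {par c}"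
proof -
  note r = residual_insert[OF A c]
  have p: "residual (insert c A) (par c) < M" "residual (insert c A) c < M"
    using r(1) le c by (metis add.commute less_add_Suc1 order.strict_trans2)+
  show "\<forall>x\<in>insert c A. residual (insert c A) x \<le> M"
  proof
    fix x assume "x \<in> insert c A"
    then consider "x = c" | "x = par c" | "x \<in> A" "x \<noteq> par c" by blast
    then show "residual (insert c A) x \<le> M" by cases (use p r(2) le in auto)
  qed
  show "maximal (insert c A) M = maximal A M - {par c}"
  proof (rule set_eqI)
    fix x
    show "x \<in> maximal (insert c A) M \<longleftrightarrow> x \<in> maximal A M - {par c}"
      using p r(2)[of x] c by (cases "x = par c"; cases "x = c") (auto simp: maximal_def)
  qed
qed

lemma card_ge_two_obtain:
  assumes "card S \<ge> 2"
  obtains x y where "x \<in> S" "y \<in> S" "x \<noteq> y"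
proof -
  obtain T where "T \<subseteq> S" "card T = 2" using assms by (meson obtain_subset_with_card_n)
  then show thesis using that by (auto simp: card_2_iff)
qed

text \<open>Whichever edge turns red, \<open>v\<close> becomes the image of a child of
  \<open>x\<close> or \<open>y\<close>. A dirty \<open>v\<close> is allowed, provided both offered
  edges are free.\<close>

lemma wins_pair:
  assumes pl: "placed A \<phi> P R B" and ti: "tidy A \<phi> P D R B"
    and x: "x \<in> A" "y \<in> A" "x \<noteq> y" "residual A x > 0" "residual A y > 0" and v: "v \<in> P"
    and free: "{\<phi> x, v} \<notin> R \<union> B" "{\<phi> y, v} \<notin> R \<union> B"
    and win: "\<And>c \<phi>' R' B'. c \<in> VF - A \<Longrightarrow> par c = x \<or> par c = y \<Longrightarrow>
      placed (insert c A) \<phi>' (P - {v}) R' B' \<Longrightarrow>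
      tidy (insert c A) \<phi>' (P - {v}) (D - {v}) R' B' \<Longrightarrow> wins n R' B'"
  shows "wins (Suc n) R B"
proof -
  have A: "parent_closed A" using placed_finite[OF pl] by auto
  have step: "wins n (insert {\<phi> x, v} R) (insert {\<phi> y, v} B)"
    if xy: "x \<in> A" "y \<in> A" "residual A x > 0"
      and sel: "x = x' \<or> x = y'"
      and win: "\<And>c \<phi>' R' B'. c \<in> VF - A \<Longrightarrow> par c = x' \<or> par c = y' \<Longrightarrow>
        placed (insert c A) \<phi>' (P - {v}) R' B' \<Longrightarrow>
        tidy (insert c A) \<phi>' (P - {v}) (D - {v}) R' B' \<Longrightarrow> wins n R' B'" for x y x' y'
  proof -
    obtain c where c: "c \<in> VF - A" "par c = x" using residual_pos_child[OF A xy(3)] by blast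
    have pc: "par c \<in> A" using c xy by simp
    have "{\<phi> y, v} \<subseteq> \<phi> ` A \<union> P" using xy v by auto
    then show ?thesis
      using win[OF c(1) sel[folded c(2)] placed_extend[OF pl c(1) pc v] tidy_extend[OF pl ti c(1) pc v xy(2)]]
      unfolding c(2) by blast
  qed
  have "\<phi> x \<noteq> \<phi> y" "\<phi> x \<noteq> v" "\<phi> y \<noteq> v" "v \<in> V"
    using pl x v by (auto simp: placed_def inj_on_def)
  moreover from this have "{\<phi> x, v} \<noteq> {\<phi> y, v}" by (auto simp: doubleton_eq_iff)
  moreover have "wins n (insert {\<phi> x, v} R) (insert {\<phi> y, v} B)"
    by (rule step[of x y x y]) (use x win in auto)
  moreover have "wins n (insert {\<phi> y, v} R) (insert {\<phi> x, v} B)"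
    by (rule step[of y x x y]) (use x win in auto)
  ultimately show ?thesis
    using free by (intro wins_offer[OF pl x(1,2)])
qed

lemma discard_all:
  assumes pl: "placed A \<phi> P R B" and ti: "tidy A \<phi> P D R B"
  shows "placed A \<phi> {} R B"
proof -
  have "placed A \<phi> (P - Q) R B \<and> tidy A \<phi> (P - Q) (D - Q) R B" if "finite Q" "Q \<subseteq> P" for Q
    using that
  proof (induction Q)
    case empty
    then show ?case using pl ti by simp
  next
    case (insert w Q)
    then have *: "placed A \<phi> (P - Q) R B" "tidy A \<phi> (P - Q) (D - Q) R B" "w \<in> P - Q" by auto
    show ?case unfolding Diff_insert[of _ w Q] by (intro conjI discard[OF *])
  qed
  from this[OF placed_finite(2)[OF pl]] show ?thesis by simp
qed

text \<open>One round beyond the missing edges is reserved for the wasted round of the endgame. In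
  the induction measure the missing vertices weigh double, because a sure move embeds one vertex but
  dirties another.\<close>

lemma wins_balanced:
  assumes "placed A \<phi> P R B" "tidy A \<phi> P D R B" "balanced A P D M"
  shows "wins (Suc (card (VF - A))) R B"
  using assms
proof (induction "2 * card (VF - A) + card D + M" arbitrary: A \<phi> P D R B M rule: less_induct)
  case less
  note pl = less.prems(1) and ti = less.prems(2)
  have le: "card (VF - A) \<le> card P" and res: "\<forall>x\<in>A. residual A x \<le> M"
    and bD: "D \<noteq> {} \<Longrightarrow> 3 * M + card D \<le> card P"
    and b0: "D = {} \<Longrightarrow> 3 * M + min (card (maximal A M)) 3 \<le> card P + 2"
    using less.prems(3) by (auto simp: balanced_def)
  have A: "parent_closed A" and finA: "finite A" and finP: "finite P" using placed_finite[OF pl] by auto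
  have DP: "D \<subseteq> P" using ti by (simp add: tidy_def)
  then have finD: "finite D" using finP finite_subset by blast
  have finM: "finite (maximal A M)" using finA by (simp add: maximal_def)
  have injA: "inj_on \<phi> A" and disj: "\<phi> ` A \<inter> P = {}" using pl by (auto simp: placed_def)
  have finR: "finite (VF - A)" using finite_VF by simp
  let ?m = "card (VF - A)" and ?\<mu> = "card (maximal A M)"
  have clean: "{a, v} \<notin> R \<union> B" if "v \<in> P - D" for a v
    using tidy_edge(1)[OF ti, of v "{a, v}"] that by auto
  have many: "?\<mu> * M \<le> ?m"
  proof -
    have "?\<mu> * M = (\<Sum>x\<in>maximal A M. residual A x)" by (simp add: maximal_def)
    also have "\<dots> \<le> (\<Sum>x\<in>A. residual A x)"
      by (rule sum_mono2) (use finA in \<open>auto simp: maximal_def\<close>)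
    finally show ?thesis using sum_residual[OF A] by simp
  qed
  have m1: "card (VF - insert c A) = ?m - 1" if "c \<in> VF - A" for c
  proof -
    have "VF - insert c A = (VF - A) - {c}" by auto
    then show ?thesis using that by simp
  qed
  show ?case
  proof (cases "?m = 0")
    case True
    then have "A = VF" using finR closed_subset[OF A] by auto
    moreover have "placed A \<phi> {} R B" by (rule discard_all[OF pl ti])
    ultimately show ?thesis by (intro waiter_wins_goal) blast
  next
    case m: False
    have Mpos: "M > 0"
    proof (rule ccontr)
      assume "\<not> M > 0"
      then have "(\<Sum>x\<in>A. residual A x) = 0" using res by auto
      then show False using m sum_residual[OF A] by simp
    qed
    note IH = less.hyps
    consider (none) "?\<mu> = 0" | (final) "?\<mu> > 0" "M = 1" "card P = ?m" "card D \<le> 1"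
      | (dirty) "?\<mu> > 0" "\<not> (M = 1 \<and> card P = ?m \<and> card D \<le> 1)" "D \<noteq> {}"
      | (pair) "?\<mu> \<ge> 2" "\<not> (M = 1 \<and> card P = ?m)" "D = {}"
      | (sure) "?\<mu> = 1" "D = {}"
      by (cases "D = {}"; cases "?\<mu> = 0"; cases "?\<mu> = 1"; fastforce)
    then show ?thesis
    proof cases
      case none
      have "residual A x \<le> M - 1" if "x \<in> A" for x
      proof -
        have "maximal A M = {}" using none finM by auto
        then have "residual A x \<noteq> M" using that by (auto simp: maximal_def)
        then show ?thesis using res that by fastforce
      qed
      \<comment> \<open>Lowering \<open>M\<close> by one frees 3 in \<open>3 * M\<close>, the
        largest possible value of the new \<open>min _ 3\<close>.\<close>
      then have bal: "balanced A P D (M - 1)"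
        using le bD b0 Mpos unfolding balanced_def by fastforce
      show ?thesis by (rule IH[OF _ pl ti bal]) (use Mpos in simp)
    next
      case final
      \<comment> \<open>For a clean pool \<open>?\<mu> = ?m = card P\<close>, and
        \<open>3 + min ?\<mu> 3 \<le> ?\<mu> + 2\<close> forces \<open>?\<mu> \<ge> 4\<close>.
        Otherwise \<open>3 + card D \<le> card P\<close> suffices.\<close>
      have "card P \<ge> 4"
      proof (cases "D = {}")
        case True
        have "?\<mu> = ?m"
        proof -
          have "(\<Sum>x\<in>A. residual A x) = (\<Sum>x\<in>maximal A M. residual A x)"
            by (rule sum.mono_neutral_right)
              (use finA res final in \<open>auto simp: maximal_def le_Suc_eq\<close>)
          then show ?thesis using final sum_residual[OF A] by (simp add: maximal_def)
        qed
        then show ?thesis using b0[OF True] final by auto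
      next
        case False
        then have "card D > 0" using finD by auto
        then show ?thesis using bD[OF False] final by linarith
      qed
      then show ?thesis
        using wins_endgame[OF pl ti] final res by simp
    next
      case dirty
      then obtain w where w: "w \<in> D" by blast
      have wP: "w \<in> P" using w DP by auto
      have cD: "card D > 0" "card (D - {w}) = card D - 1" "card (P - {w}) = card P - 1"
        using w wP finD by (auto simp: card_gt_0_iff)
      \<comment> \<open>\<open>Op\<close> holds the embedded vertices that need children,
        \<open>Fr\<close> those whose edge to \<open>w\<close> is free. The single coloured edge at
        \<open>w\<close> blocks at most one of \<open>Op\<close>.\<close>
      define Op where "Op = {x \<in> A. residual A x > 0}"
      define Fr where "Fr = {x \<in> Op. {\<phi> x, w} \<notin> R \<union> B}"
      have blocked: "x = y" if "x \<in> Op - Fr" "y \<in> Op - Fr" for x y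
      proof -
        have "{\<phi> x, w} \<in> R \<union> B" "{\<phi> y, w} \<in> R \<union> B" "x \<in> A" "y \<in> A"
          using that by (auto simp: Fr_def Op_def)
        then have "{\<phi> x, w} = {\<phi> y, w}" "x \<in> A" "y \<in> A"
          using tidy_edge_unique[OF ti wP] by auto
        then show ?thesis using injA by (auto simp: doubleton_eq_iff inj_on_def)
      qed
      have finO: "finite Op" "finite Fr" "Fr \<subseteq> Op" using finA by (auto simp: Op_def Fr_def)
      have bl1: "card (Op - Fr) \<le> 1"
        using blocked finO card_le_Suc0_iff_eq[of "Op - Fr"] by auto
      have MO: "maximal A M \<subseteq> Op" using Mpos by (auto simp: maximal_def Op_def)
      show ?thesis
      proof (cases "card Fr \<ge> 2")
        case True
        \<comment> \<open>Of three maximal trees at most one is blocked. Choosing two maximal ones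
          matters when \<open>w\<close> is the last dirty vertex, since then the number of maximal
          trees enters the balance.\<close>
        obtain x y where xy: "x \<in> Fr" "y \<in> Fr" "x \<noteq> y"
          and top: "?\<mu> \<ge> 3 \<Longrightarrow> x \<in> maximal A M \<and> y \<in> maximal A M"
        proof (cases "?\<mu> \<ge> 3")
          case mu: True
          have "maximal A M - (Op - Fr) \<subseteq> maximal A M \<inter> Fr" using MO by auto
          then have "card (maximal A M - (Op - Fr)) \<le> card (maximal A M \<inter> Fr)"
            using finO by (intro card_mono) auto
          moreover have "?\<mu> - card (Op - Fr) \<le> card (maximal A M - (Op - Fr))"
            by (rule diff_card_le_card_Diff) (use finO in auto)
          ultimately have "card (maximal A M \<inter> Fr) \<ge> 2" using mu bl1 by linarith
          then show thesis using that by (elim card_ge_two_obtain) auto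
        next
          case False
          then show thesis using that True by (elim card_ge_two_obtain) auto
        qed
        have xyA: "x \<in> A" "y \<in> A" "residual A x > 0" "residual A y > 0"
          "{\<phi> x, w} \<notin> R \<union> B" "{\<phi> y, w} \<notin> R \<union> B"
          using xy by (auto simp: Fr_def Op_def)
        have "wins (Suc ?m) R B"
        proof (rule wins_pair[OF pl ti xyA(1,2) xy(3) xyA(3,4) wP xyA(5,6)])
          fix c \<phi>' R' B'
          assume c: "c \<in> VF - A" "par c = x \<or> par c = y"
            and pl': "placed (insert c A) \<phi>' (P - {w}) R' B'"
            and ti': "tidy (insert c A) \<phi>' (P - {w}) (D - {w}) R' B'"
          have pc: "par c \<in> A" using c xyA by auto
          note mx = maximal_insert[OF A c(1) pc res]
          have "3 * M + min (card (maximal (insert c A) M)) 3 \<le> card (P - {w}) + 2" if "D - {w} = {}"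
          proof -
            have D1: "card D = 1" using that cD by (metis card.empty Suc_diff_1 One_nat_def)
            have P1: "3 * M + 1 \<le> card P" using bD dirty D1 by simp
            have mu': "card (maximal (insert c A) M) \<le> ?\<mu>"
              unfolding mx(2) using finM by (simp add: card_Diff1_le)
            show ?thesis
            \<comment> \<open>In the tight case at most two maximal trees may remain. Four would
              need \<open>4 * M \<le> 3 * M + 1\<close>, so \<open>M = 1\<close> and
              \<open>card P = ?m\<close>, which belongs to the case \<open>final\<close>; with
              exactly three, the move removes one.\<close>
            proof (cases "card P = 3 * M + 1 \<and> ?\<mu> \<ge> 3")
              case tight: True
              then have "par c \<in> maximal A M" using top c by auto
              then have eq: "card (maximal (insert c A) M) = ?\<mu> - 1" unfolding mx(2) by simp
              have "?\<mu> = 3"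
              proof (rule ccontr)
                assume "?\<mu> \<noteq> 3"
                then have "4 * M \<le> ?\<mu> * M" using tight by (intro mult_right_mono) auto
                then have "4 * M \<le> ?m" "?m \<le> 3 * M + 1" using many le tight by linarith+
                then have "M = 1" "card P = ?m" using Mpos tight by auto
                then show False using dirty D1 by auto
              qed
              then show ?thesis using eq tight cD by auto
            next
              case False
              then show ?thesis using P1 mu' cD by auto
            qed
          qed
          then have "balanced (insert c A) (P - {w}) (D - {w}) M"
            using mx(1) le bD dirty cD m m1[OF c(1)] unfolding balanced_def by auto
          moreover have "2 * card (VF - insert c A) + card (D - {w}) + M < 2 * ?m + card D + M"
            using cD m m1[OF c(1)] by auto
          ultimately have "wins (Suc (card (VF - insert c A))) R' B'"
            using IH[OF _ pl' ti'] by blast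
          then show "wins ?m R' B'" using m1[OF c(1)] m by simp
        qed
        then show ?thesis .
      next
        case False
        have "card Op = card Fr + card (Op - Fr)"
          using finO card_Un_disjoint[of Fr "Op - Fr"] by (auto simp: Un_absorb1)
        then have O2: "card Op \<le> 2" using False bl1 by linarith
        have mu2: "?\<mu> \<le> 2" using card_mono[OF finO(1) MO] O2 by linarith
        have "?m = (\<Sum>x\<in>Op. residual A x)"
          unfolding sum_residual[OF A, symmetric]
          by (rule sum.mono_neutral_right) (use finA in \<open>auto simp: Op_def\<close>)
        also have "\<dots> \<le> card Op * M"
          using sum_bounded_above[of Op "residual A" M] res by (auto simp: Op_def)
        also have "\<dots> \<le> 2 * M" using O2 by simp
        finally have "?m \<le> 2 * M" .
        then have bal: "balanced A (P - {w}) (D - {w}) M"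
          using res bD[OF dirty(3)] cD mu2 Mpos unfolding balanced_def by auto
        show ?thesis
          by (rule IH[OF _ discard[OF pl ti wP] bal]) (use cD in simp)
      qed
    next
      case pair
      obtain x y where xy: "x \<in> maximal A M" "y \<in> maximal A M" "x \<noteq> y"
        using pair(1) by (rule card_ge_two_obtain)
      have "P \<noteq> {}" using le m by auto
      then obtain v where v: "v \<in> P" by blast
      have xyA: "x \<in> A" "y \<in> A" "residual A x > 0" "residual A y > 0"
        using xy Mpos by (auto simp: maximal_def)
      have cP: "card (P - {v}) = card P - 1" "card P > 0" using v finP by (auto simp: card_gt_0_iff)
      have "wins (Suc ?m) R B"
      proof (rule wins_pair[OF pl ti xyA(1,2) xy(3) xyA(3,4) v])
        show "{\<phi> x, v} \<notin> R \<union> B" "{\<phi> y, v} \<notin> R \<union> B" using clean v pair by blast+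
        fix c \<phi>' R' B'
        assume c: "c \<in> VF - A" "par c = x \<or> par c = y"
          and pl': "placed (insert c A) \<phi>' (P - {v}) R' B'"
          and ti': "tidy (insert c A) \<phi>' (P - {v}) (D - {v}) R' B'"
        have pc: "par c \<in> A" "par c \<in> maximal A M" using c xyA xy by auto
        note mx = maximal_insert[OF A c(1) pc(1) res]
        have mu': "card (maximal (insert c A) M) = ?\<mu> - 1" using pc unfolding mx(2) by simp
        \<comment> \<open>Up to three maximal trees, both sides drop by one. Beyond that the minimum
          stays 3, and \<open>card P \<ge> 3 * M + 2\<close> is needed: it follows from
          \<open>4 * M \<le> card P\<close> if \<open>M \<ge> 2\<close>, and from the spare vertex
          \<open>card P > ?m \<ge> 4\<close> if \<open>M = 1\<close>.\<close>
        have "3 * M + min (?\<mu> - 1) 3 \<le> card P + 1"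
        proof (cases "?\<mu> \<le> 3")
          case True
          then show ?thesis using b0 pair by auto
        next
          case False
          then have mu4: "?\<mu> \<ge> 4" by simp
          then have *: "4 * M \<le> ?\<mu> * M" by (intro mult_right_mono) auto
          show ?thesis
          proof (cases "M = 1")
            case True
            then have "card P \<ge> 5" using pair many le mu4 by auto
            then show ?thesis using True by auto
          next
            case False
            then have "M \<ge> 2" using Mpos by simp
            moreover have "4 * M \<le> card P" using * many le by linarith
            ultimately show ?thesis by auto
          qed
        qed
        then have "balanced (insert c A) (P - {v}) (D - {v}) M"
          using mx(1) le m m1[OF c(1)] cP mu' pair unfolding balanced_def by auto
        moreover have "2 * card (VF - insert c A) + card (D - {v}) + M < 2 * ?m + card D + M"
          using m m1[OF c(1)] pair by auto
        ultimately have "wins (Suc (card (VF - insert c A))) R' B'"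
          using IH[OF _ pl' ti'] by blast
        then show "wins ?m R' B'" using m1[OF c(1)] m by simp
      qed
      then show ?thesis .
    next
      case sure
      then obtain x where x: "maximal A M = {x}" by (auto simp: card_1_singleton_iff)
      then have xA: "x \<in> A" "residual A x > 0" using Mpos by (auto simp: maximal_def)
      obtain c where c: "c \<in> VF - A" "par c = x" using residual_pos_child[OF A xA(2)] by blast
      have pc: "par c \<in> A" using c xA by simp
      have b: "3 * M \<le> card P + 1" using b0 sure by auto
      then have "card P \<ge> 2" using Mpos by linarith
      then obtain v w where vw: "v \<in> P" "w \<in> P" "v \<noteq> w" by (rule card_ge_two_obtain)
      note mx = maximal_insert[OF A c(1) pc res]
      have "wins (Suc ?m) R B"
      proof (rule wins_sure[OF pl xA(1) vw, where P' = P])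
        show "{\<phi> x, v} \<notin> R \<union> B" "{\<phi> x, w} \<notin> R \<union> B" using clean vw sure by blast+
        fix v w assume vw: "v \<in> P" "w \<in> P" "v \<noteq> w"
        have "\<forall>z\<in>insert c A. residual (insert c A) z \<le> M - 1"
        proof
          fix z assume z: "z \<in> insert c A"
          have "z \<notin> maximal (insert c A) M" unfolding mx(2) x c by simp
          then have "residual (insert c A) z \<noteq> M" using z by (auto simp: maximal_def)
          then show "residual (insert c A) z \<le> M - 1" using mx(1) z by fastforce
        qed
        \<comment> \<open>With one dirty vertex and one pool vertex less, the requirement
          \<open>3 * (M - 1) + 1 \<le> card P - 1\<close> is exactly \<open>b\<close>.\<close>
        then have bal: "balanced (insert c A) (P - {v}) {w} (M - 1)"
          using b le m m1[OF c(1)] vw finP Mpos unfolding balanced_def by auto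
        have "{\<phi> (par c), w} \<subseteq> \<phi> ` A \<union> P" using pc vw by auto
        note pl' = placed_extend[OF pl c(1) pc vw(1) this]
        have ti': "tidy (insert c A) (\<phi>(c := v)) (P - {v}) {w}
            (insert {\<phi> (par c), v} R) (insert {\<phi> (par c), w} B)"
          using tidy_extend_spoil[OF pl ti c(1) pc, of v w] vw sure by simp
        have "2 * card (VF - insert c A) + card {w} + (M - 1) < 2 * ?m + card D + M"
          using m m1[OF c(1)] sure Mpos by auto
        then have "wins (Suc (card (VF - insert c A))) (insert {\<phi> (par c), v} R) (insert {\<phi> (par c), w} B)"
          using IH[OF _ pl' ti' bal] by blast
        then show "wins ?m (insert {\<phi> x, v} R) (insert {\<phi> x, w} B)"
          using m1[OF c(1)] m c by simp
      qed (use vw in auto)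
      then show ?thesis .
    qed
  qed
qed

end

section \<open>From the trees and stars to the balanced game and back\<close>

theorem theorem3p19:
  fixes q t s :: nat
    and VT :: "nat \<Rightarrow> 'a set" and ET :: "nat \<Rightarrow> 'a set set" and rt :: "nat \<Rightarrow> 'a"
    and U V :: "'b set" and u :: "nat \<Rightarrow> 'b" and L :: "nat \<Rightarrow> 'b set"
    and R0 Bl0 :: "'b set set"
  assumes "q < t"
    and trees: "\<forall>i\<in>{1..s}. is_tree (VT i) (ET i) \<and> rt i \<in> VT i"
    and disj_trees: "\<forall>i\<in>{1..s}. \<forall>j\<in>{1..s}. i \<noteq> j \<longrightarrow> VT i \<inter> VT j = {}"
    and eF: "card (\<Union>i\<in>{1..s}. ET i) \<le> t"
    and sizes: "\<forall>i\<in>{1..s}. 1 \<le> card (ET i) \<and> real (card (ET i)) < (real t - real q) / 3"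
    and "finite U" and "finite V" and "U \<inter> V = {}" and "card U = s" and "card V = t"
    and "inj_on u {1..s}" and "u ` {1..s} = U"
    and "\<forall>i\<in>{1..s}. L i \<subseteq> V"
    and "\<forall>i\<in>{1..s}. \<forall>j\<in>{1..s}. i \<noteq> j \<longrightarrow> L i \<inter> L j = {}"
    and "(\<Sum>i=1..s. card (L i)) = q"
    and "R0 \<inter> Bl0 = {}" and "R0 \<union> Bl0 \<subseteq> board_edges (U \<union> V)"
    and "{{u i, v} | i v. i \<in> {1..s} \<and> v \<in> L i} \<subseteq> Bl0"
    and "\<forall>e\<in>R0 \<union> Bl0. \<not> e \<subseteq> U \<longrightarrow> e \<in> {{u i, v} | i v. i \<in> {1..s} \<and> v \<in> L i}"
  shows "waiter_wins
           (\<lambda>R Bl. \<exists>\<phi>.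
              inj_on \<phi> (\<Union>i\<in>{1..s}. VT i)
              \<and> \<phi> ` (\<Union>i\<in>{1..s}. VT i) \<subseteq> U \<union> V
              \<and> (\<forall>e\<in>(\<Union>i\<in>{1..s}. ET i). \<phi> ` e \<in> R)
              \<and> (\<forall>i\<in>{1..s}. \<phi> (rt i) = u i)
              \<and> (\<forall>e\<in>R \<union> Bl. e \<inter> \<phi> ` (\<Union>i\<in>{1..s}. VT i) \<noteq> {})
              \<and> (\<forall>w\<in>(U \<union> V) - \<phi> ` (\<Union>i\<in>{1..s}. VT i).
                   card {e\<in>R \<union> Bl. w \<in> e} \<le> 1
                   \<and> (\<forall>x. {w, x} \<in> R \<union> Bl \<longrightarrow>
                        x \<notin> \<phi> ` {y \<in> (\<Union>i\<in>{1..s}. VT i).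
                                   card {e \<in> (\<Union>i\<in>{1..s}. ET i). y \<in> e} = 1
                                   \<and> y \<notin> rt ` {1..s}})))
           (\<lambda>e. \<not> e \<subseteq> U)
           (U \<union> V)
           (card (\<Union>i\<in>{1..s}. ET i) + 1)
           R0 Bl0"
proof -
  let ?I = "{1..s}"
  define VF where "VF = (\<Union>i\<in>?I. VT i)"
  define EF where "EF = (\<Union>i\<in>?I. ET i)"
  define Rt where "Rt = rt ` ?I"
  note disjL = assms(14) and R0 = assms(17) and only = assms(19)
  have "\<exists>par dep. (\<forall>y\<in>VT i - {rt i}. par y \<in> VT i \<and> dep (par y) < (dep y :: nat))
      \<and> ET i = (\<lambda>y. {y, par y}) ` (VT i - {rt i})" if "i \<in> ?I" for i
    by (rule tree_parent_function) (use trees that in auto)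
  then have "\<forall>i\<in>?I. \<exists>pd. (\<forall>y\<in>VT i - {rt i}. fst pd y \<in> VT i \<and> snd pd (fst pd y) < (snd pd y :: nat))
      \<and> ET i = (\<lambda>y. {y, fst pd y}) ` (VT i - {rt i})"
    by simp
  from bchoice[OF this] obtain pd where pd: "\<forall>i\<in>?I. (\<forall>y\<in>VT i - {rt i}. fst (pd i) y \<in> VT i
      \<and> snd (pd i) (fst (pd i) y) < (snd (pd i) y :: nat)) \<and> ET i = (\<lambda>y. {y, fst (pd i) y}) ` (VT i - {rt i})"
    by blast
  define Par where "Par i = fst (pd i)" for i
  define Dep where "Dep i = snd (pd i)" for i
  have PD: "Par i y \<in> VT i \<and> Dep i (Par i y) < Dep i y" if "i \<in> ?I" "y \<in> VT i - {rt i}" for i y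
    using pd that unfolding Par_def Dep_def by blast
  have ET: "ET i = (\<lambda>y. {y, Par i y}) ` (VT i - {rt i})" if "i \<in> ?I" for i
    using pd that unfolding Par_def by blast
  \<comment> \<open>Disjointness makes the tree containing a vertex unique, so the parent and depth
    functions of the trees can be glued together.\<close>
  define idx where "idx y = (THE i. i \<in> ?I \<and> y \<in> VT i)" for y
  have idx: "idx y = i" if "i \<in> ?I" "y \<in> VT i" for i y
    unfolding idx_def by (rule the_equality) (use that disj_trees in blast)+
  define par where "par y = Par (idx y) y" for y
  define dep where "dep y = Dep (idx y) y" for y
  have par: "par y \<in> VT i" "dep (par y) < dep y" if "i \<in> ?I" "y \<in> VT i - {rt i}" for i y
    using PD[OF that] idx that by (auto simp: par_def dep_def)
  have ET_par: "ET i = (\<lambda>y. {y, par y}) ` (VT i - {rt i})" if "i \<in> ?I" for i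
    unfolding ET[OF that] by (rule image_cong) (use idx that in \<open>auto simp: par_def\<close>)
  have root: "rt i \<in> VT i" if "i \<in> ?I" for i using trees that by blast
  have Rt_VT: "x = rt i" if x: "x \<in> Rt" "x \<in> VT i" and i: "i \<in> ?I" for x i
  proof -
    obtain j where j: "j \<in> ?I" "x = rt j" using x(1) by (auto simp: Rt_def)
    then have "j = i" using idx[OF i x(2)] idx[OF j(1)] root by simp
    then show ?thesis using j by simp
  qed
  have nonroot: "\<exists>i\<in>?I. y \<in> VT i - {rt i}" if "y \<in> VF - Rt" for y
    using that by (auto simp: VF_def Rt_def)
  have VT_Rt: "VT i - {rt i} \<subseteq> VF - Rt" if "i \<in> ?I" for i
    using that Rt_VT by (auto simp: VF_def)
  have finite_VF: "finite VF"
    using trees by (auto simp: VF_def is_tree_def is_graph_def)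
  interpret rooted_forest VF Rt par dep
  proof
    show "Rt \<subseteq> VF" using root by (auto simp: Rt_def VF_def)
    show "par y \<in> VF" "dep (par y) < dep y" if "y \<in> VF - Rt" for y
      using nonroot[OF that] par unfolding VF_def by blast+
  qed (rule finite_VF)
  have EF: "EF = (\<lambda>y. {y, par y}) ` (VF - Rt)"
  proof -
    have "VF - Rt = (\<Union>i\<in>?I. VT i - {rt i})" using nonroot VT_Rt by blast
    then show ?thesis unfolding EF_def using ET_par by (simp add: image_UN)
  qed
  have inj_EF: "inj_on (\<lambda>y. {y, par y}) (VF - Rt)"
    by (rule inj_on_parent_edge) (rule dep_par)
  have card_EF: "card EF = card (VF - Rt)"
    unfolding EF by (rule card_image[OF inj_EF])
  have inj_rt: "inj_on rt ?I"
    by (rule inj_onI) (metis idx root)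
  define pos where "pos x = u (inv_into ?I rt x)" for x
  have pos: "pos (rt i) = u i" if "i \<in> ?I" for i
    using that inj_rt by (simp add: pos_def)
  interpret forest_board VF Rt par dep U V pos
    by unfold_locales (fact assms(7,8))+
  define D where "D = (\<Union>i\<in>?I. L i)"
  have finL: "finite (L i)" if "i \<in> ?I" for i
    using that assms(13) \<open>finite V\<close> finite_subset by blast
  have cardD: "card D = q"
    unfolding D_def assms(15)[symmetric] using finL disjL by (intro card_UN_disjoint) auto
  have pos_Rt: "pos ` Rt = U"
    using pos assms(12) unfolding Rt_def image_image by (auto simp: image_def)
  have uU: "u i \<in> U" if "i \<in> ?I" for i using that assms(12) by blast
  have closedR: "parent_closed Rt" using Rt_VF by (simp add: parent_closed_def)
  \<comment> \<open>Initially the roots occupy all of \<open>U\<close> and the pool is all of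
    \<open>V\<close>, so no board vertex has been discarded.\<close>
  have placed0: "placed Rt pos V R0 Bl0"
  proof (rule placedI)
    show "inj_on pos Rt"
    proof (rule inj_onI)
      fix x y assume xy: "x \<in> Rt" "y \<in> Rt" "pos x = pos y"
      then obtain i j where ij: "i \<in> ?I" "x = rt i" "j \<in> ?I" "y = rt j" unfolding Rt_def by blast
      then have "u i = u j" using xy pos by simp
      then show "x = y" using inj_onD[OF assms(11)] ij by blast
    qed
    show "pos ` Rt \<subseteq> U \<union> V" "pos ` Rt \<inter> V = {}" using pos_Rt \<open>U \<inter> V = {}\<close> by auto
    fix e assume e: "e \<in> R0 \<union> Bl0"
    then have eW: "e \<subseteq> U \<union> V" using R0 by (auto simp: board_edges_def)
    then show "e \<subseteq> pos ` Rt \<union> V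
      \<or> (\<exists>w x. e = {w, pos x} \<and> w \<notin> pos ` Rt \<union> V \<and> x \<in> Rt \<and> nonleaf x)"
      using pos_Rt by simp
    show "e = e'" if "w \<notin> pos ` Rt \<union> V" "w \<in> e" for w e'
      using that eW pos_Rt by auto
  qed (use closedR in auto)
  have star: "\<exists>i\<in>?I. p \<in> L i \<and> e = {u i, p}" if p: "p \<in> V" "p \<in> e" and e: "e \<in> R0 \<union> Bl0" for p e
  proof -
    have "\<not> e \<subseteq> U" using p \<open>U \<inter> V = {}\<close> by auto
    then obtain i v where iv: "e = {u i, v}" "i \<in> ?I" "v \<in> L i" using bspec[OF only e] by blast
    moreover have "p \<noteq> u i" using uU[OF iv(2)] p \<open>U \<inter> V = {}\<close> by auto
    ultimately show ?thesis using p by blast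
  qed
  \<comment> \<open>The star leaves are the initial dirty vertices. Disjoint stars give each one a
    single edge, and its centre is the image of a root, hence of a non-leaf.\<close>
  have tidy0: "tidy Rt pos V D R0 Bl0"
  proof (rule tidyI)
    show "D \<subseteq> V" using assms(13) by (auto simp: D_def)
    fix p e assume p: "p \<in> V" "p \<in> e" and e: "e \<in> R0 \<union> Bl0"
    obtain i where i: "i \<in> ?I" "p \<in> L i" "e = {u i, p}" using star[OF p e] by blast
    show "p \<in> D" using i by (auto simp: D_def)
    show "\<exists>x\<in>Rt. nonleaf x \<and> e = {p, pos x}"
    proof
      show "rt i \<in> Rt" using i by (auto simp: Rt_def)
      then show "nonleaf (rt i) \<and> e = {p, pos (rt i)}"
        using i pos by (simp add: nonleaf_def insert_commute)
    qed
    show "e = e'" if e': "p \<in> e'" "e' \<in> R0 \<union> Bl0" for e'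
    proof -
      obtain j where j: "j \<in> ?I" "p \<in> L j" "e' = {u j, p}" using star[OF p(1) e'] by blast
      then have "i = j" using i disjL by blast
      then show ?thesis using i j by simp
    qed
  qed
  have nearest: "nearest Rt y = rt i" if "y \<in> VF" and i: "i \<in> ?I" and "y \<in> VT i" for y i
    using that(1,3)
  proof (induction rule: forest_induct)
    case (step y)
    show ?case
    proof (cases "y \<in> Rt")
      case True
      then show ?thesis using nearest_in Rt_VT step i by auto
    next
      case False
      moreover from this have "y \<in> VT i - {rt i}" using step i by (auto simp: Rt_def)
      ultimately show ?thesis using nearest_step[OF closedR] step par(1)[OF i] by auto
    qed
  qed
  have residual: "residual Rt (rt i) = card (ET i)" if i: "i \<in> ?I" for i
  proof -
    have "{y \<in> VF - Rt. nearest Rt y = rt i} = VT i - {rt i}"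
    proof (intro equalityI subsetI)
      fix y assume y: "y \<in> {y \<in> VF - Rt. nearest Rt y = rt i}"
      then obtain j where j: "j \<in> ?I" "y \<in> VT j - {rt j}" using nonroot by blast
      then have "rt i = rt j" using nearest[of y j] y by auto
      then have "i = j" using inj_onD[OF inj_rt] i j by blast
      then show "y \<in> VT i - {rt i}" using j by simp
    next
      fix y assume y: "y \<in> VT i - {rt i}"
      then have "y \<in> VF - Rt" using VT_Rt[OF i] by blast
      then show "y \<in> {y \<in> VF - Rt. nearest Rt y = rt i}" using nearest i y by auto
    qed
    moreover have "card (ET i) = card (VT i - {rt i})"
      unfolding ET_par[OF i] by (rule card_image[OF inj_on_parent_edge]) (rule par(2)[OF i])
    ultimately show ?thesis by (simp add: residual_def)
  qed
  \<comment> \<open>The largest integer with \<open>3 * M < t - q\<close>. The strictness supplies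
    the extra 1 that the balance needs when \<open>q = 0\<close>, where \<open>min _ 3\<close> may
    be 3.\<close>
  define M where "M = (t - q - 1) div 3"
  have M: "3 * M + q + 1 \<le> t" using \<open>q < t\<close> unfolding M_def by linarith
  have "residual Rt x \<le> M" if x: "x \<in> Rt" for x
  proof -
    obtain i where i: "i \<in> ?I" "x = rt i" using x by (auto simp: Rt_def)
    have "real (card (ET i)) < (real t - real q) / 3" using sizes i(1) by blast
    then have "real (3 * card (ET i) + q) < real t" by simp
    then have "3 * card (ET i) + q < t" by (simp only: of_nat_less_iff)
    then have "card (ET i) * 3 \<le> t - q - 1" by linarith
    then have "card (ET i) \<le> M" unfolding M_def by (simp add: less_eq_div_iff_mult_less_eq)
    then show ?thesis using residual[OF i(1)] i(2) by simp
  qed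
  then have "balanced Rt V D M"
    using eF card_EF M cardD \<open>card V = t\<close> unfolding balanced_def EF_def[symmetric] by auto
  then have "wins (card EF + 1) R0 Bl0"
    using wins_balanced[OF placed0 tidy0] card_EF by simp
  then show ?thesis
    unfolding VF_def[symmetric] EF_def[symmetric] Rt_def[symmetric]
  proof (rule waiter_wins_mono[rotated])
    show "R0 \<union> Bl0 \<subseteq> board_edges (U \<union> V)" by (rule R0)
    fix R Bl assume "\<exists>\<phi>. placed VF \<phi> {} R Bl" and RB: "R \<union> Bl \<subseteq> board_edges (U \<union> V)"
    then obtain \<phi> where pl: "placed VF \<phi> {} R Bl" by blast
    have finRB: "finite (R \<union> Bl)"
      by (rule finite_subset[of _ "Pow (U \<union> V)"]) (use RB assms(6,7) in \<open>auto simp: board_edges_def\<close>)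
    have inj: "inj_on \<phi> VF" using pl by (simp add: placed_def)
    have meet: "e \<inter> \<phi> ` VF \<noteq> {}" if e: "e \<in> R \<union> Bl" for e
      using pl e
    proof (cases rule: placed_edge)
      case 1
      have "e \<noteq> {}" using RB e by (auto simp: board_edges_def)
      then show ?thesis using 1 by auto
    qed auto
    \<comment> \<open>A non-root with a child has two different edges, to its parent and to that
      child, so \<open>nonleaf\<close> excludes the leaves of condition (d).\<close>
    have leaf: "\<not> (card {e \<in> EF. y \<in> e} = 1 \<and> y \<notin> Rt)" if y: "y \<in> VF" "nonleaf y" for y
    proof
      assume a: "card {e \<in> EF. y \<in> e} = 1 \<and> y \<notin> Rt"
      then obtain z where z: "z \<in> VF - Rt" "par z = y" using y by (auto simp: nonleaf_def)
      have "{y, par y} \<in> {e \<in> EF. y \<in> e}" "{z, par z} \<in> {e \<in> EF. y \<in> e}"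
        using a y z unfolding EF by auto
      then have "{y, par y} = {z, par z}" using a by (metis card_1_singletonE singletonD)
      moreover have "z \<noteq> y" using z dep_par by fastforce
      moreover have "y \<in> VF - Rt" using a y by simp
      ultimately show False
        using inj_onD[OF inj_EF] z by blast
    qed
    have out: "card {e \<in> R \<union> Bl. w \<in> e} \<le> 1
        \<and> (\<forall>x. {w, x} \<in> R \<union> Bl \<longrightarrow> x \<notin> \<phi> ` {y \<in> VF. card {e \<in> EF. y \<in> e} = 1 \<and> y \<notin> Rt})"
      if w: "w \<in> U \<union> V - \<phi> ` VF" for w
    proof
      have w': "w \<notin> \<phi> ` VF \<union> {}" using w by simp
      show "card {e \<in> R \<union> Bl. w \<in> e} \<le> 1"
        using placed_edge_unique[OF pl w'] finRB by (simp add: card_le_Suc0_iff_eq)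
      show "\<forall>x. {w, x} \<in> R \<union> Bl \<longrightarrow> x \<notin> \<phi> ` {y \<in> VF. card {e \<in> EF. y \<in> e} = 1 \<and> y \<notin> Rt}"
      proof (intro allI impI)
        fix x assume e: "{w, x} \<in> R \<union> Bl"
        show "x \<notin> \<phi> ` {y \<in> VF. card {e \<in> EF. y \<in> e} = 1 \<and> y \<notin> Rt}"
          using pl e
        proof (cases rule: placed_edge)
          case 1
          then show ?thesis using w by auto
        next
          case (2 w2 z)
          then have "x = \<phi> z" using w by (auto simp: doubleton_eq_iff)
          then show ?thesis using leaf[OF 2(3,4)] inj 2(3) by (auto simp: inj_on_def)
        qed
      qed
    qed
    have base: "\<phi> ` VF \<subseteq> U \<union> V" "\<And>x. x \<in> Rt \<Longrightarrow> \<phi> x = pos x"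
      "\<And>y. y \<in> VF - Rt \<Longrightarrow> {\<phi> y, \<phi> (par y)} \<in> R"
      using pl by (auto simp: placed_def)
    have "\<phi> ` e \<in> R" if "e \<in> EF" for e
      using that base(3) unfolding EF by auto
    moreover have "\<phi> (rt i) = u i" if "i \<in> ?I" for i
      using base(2)[of "rt i"] pos that by (auto simp: Rt_def)
    ultimately have "inj_on \<phi> VF \<and> \<phi> ` VF \<subseteq> U \<union> V \<and> (\<forall>e\<in>EF. \<phi> ` e \<in> R) \<and> (\<forall>i\<in>?I. \<phi> (rt i) = u i)"
      using inj base(1) by blast
    then show "\<exists>\<phi>. inj_on \<phi> VF \<and> \<phi> ` VF \<subseteq> U \<union> V \<and> (\<forall>e\<in>EF. \<phi> ` e \<in> R)
      \<and> (\<forall>i\<in>?I. \<phi> (rt i) = u i) \<and> (\<forall>e\<in>R \<union> Bl. e \<inter> \<phi> ` VF \<noteq> {})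
      \<and> (\<forall>w\<in>U \<union> V - \<phi> ` VF. card {e \<in> R \<union> Bl. w \<in> e} \<le> 1
          \<and> (\<forall>x. {w, x} \<in> R \<union> Bl \<longrightarrow> x \<notin> \<phi> ` {y \<in> VF. card {e \<in> EF. y \<in> e} = 1 \<and> y \<notin> Rt}))"
      using meet out by (intro exI[of _ \<phi>]) simp
  qed
qed

end
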